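(* Let $\mathcal{G}=(H,\sigma,\alpha,h_0)$ be a rooted combinatorial map with underlying graph $G=(V,E)$ and root-vertex $v_0$. The mapping $\Lambda:T\mapsto\mathcal{S}_T$ is a bijection between the spanning trees of $G$ and the recurrent sandpile configurations of $G$ (with respect to the root-vertex $v_0$).
   Context: A rooted combinatorial map is $\mathcal{G}=(H,\sigma,\alpha,h_0)$ with $H$ a finite set of half-edges, $\sigma$ a permutation, $\alpha$ a fixed-point-free involution, $\langle\sigma,\alpha\rangle$ transitive on $H$, root $h_0$; underlying graph: vertices the cycles of $\sigma$, edges the pairs $\{h,\alpha(h)\}$, a half-edge being incident to the vertex containing it; $v_0$ is the vertex containing $h_0$. For a spanning tree $T$: edges in $T$ are internal, others external; the motion function $t(h)=\sigma\alpha(h)$ if the edge of $h$ is internal, $\sigma(h)$ otherwise, is a cyclic permutation of $H$; the $(\mathcal{G},T)$-order on $H$ is $h_0<t(h_0)<\dots<t^{|H|-1}(h_0)$, edges compared via their smaller half-edge. Fundamental cycle of external $e$: set of $e'$ with $T-e'+e$ a spanning tree; fundamental cocycle of internal $e$: set of $e'$ with $T-e+e'$ a spanning tree; an edge is $(\mathcal{G},T)$-active if minimal in its fundamental cycle/cocycle. The orientation $\mathcal{O}_T$ sets, for $e=\{h_1,h_2\}$ with $h_1<h_2$, tail $h_1$/head $h_2$ if $e$ is internal and tail $h_2$/head $h_1$ if external. $\mathcal{S}_T:V\to\mathbb{N}$ gives to $v$ the number of half-edges incident to $v$ that are tails in $\mathcal{O}_T$ plus the number of half-edges incident to $v$ that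 are heads in $\mathcal{O}_T$ belonging to external $(\mathcal{G},T)$-active edges. Sandpile model: a configuration is $\mathcal{S}:V\to\mathbb{N}$; $\deg(v)$ is the number of half-edges incident to $v$, $\deg(u,v)$ the number of edges joining $u\neq v$, $\deg(v,* )$ the number of non-loop edges at $v$. A vertex $v$ with $\mathcal{S}(v)\ge\deg(v)$ may topple, producing $\mathcal{S}'$ with $\mathcal{S}'(u)=\mathcal{S}(u)+\deg(u,v)$ for $u\ne v$ and $\mathcal{S}'(v)=\mathcal{S}(v)-\deg(v,* )$. $\mathcal{S}$ is stable if $\mathcal{S}(v)<\deg(v)$ for all $v\ne v_0$; it is recurrent if it is stable, $\mathcal{S}(v_0)=\deg(v_0)$, and there is a labeling $v_0,v_1,\dots,v_{|V|-1}$ of $V$ such that toppling $v_0,v_1,\dots,v_{|V|-1}$ in this order is a valid sequence of topplings leading back to $\mathcal{S}$. *)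

theory Defs
  imports "HOL-Combinatorics.Orbits"
begin

record 'h rooted_map =
  halfedges :: "'h set"
  vperm :: "'h \<Rightarrow> 'h"
  einv :: "'h \<Rightarrow> 'h"
  root_halfedge :: 'h

inductive_set generated_group :: "('h \<Rightarrow> 'h) set \<Rightarrow> ('h \<Rightarrow> 'h) set"
  for S :: "('h \<Rightarrow> 'h) set" where
  one: "id \<in> generated_group S"
| gen: "s \<in> S \<Longrightarrow> g \<in> generated_group S \<Longrightarrow> s \<circ> g \<in> generated_group S"
| gen_inv: "s \<in> S \<Longrightarrow> g \<in> generated_group S \<Longrightarrow> inv s \<circ> g \<in> generated_group S"

definition rooted_combinatorial_map :: "'h rooted_map \<Rightarrow> bool" where
  "rooted_combinatorial_map G \<longleftrightarrow>
     finite (halfedges G) \<and>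
     vperm G permutes halfedges G \<and>
     einv G permutes halfedges G \<and>
     (\<forall>h\<in>halfedges G. einv G (einv G h) = h \<and> einv G h \<noteq> h) \<and>
     (\<forall>h\<in>halfedges G. \<forall>h'\<in>halfedges G.
        \<exists>g\<in>generated_group {vperm G, einv G}. g h = h') \<and>
     root_halfedge G \<in> halfedges G"

text \<open>Vertices and edges are represented by the sets of half-edges they consist of, so that
  incidence of a half-edge to a vertex is membership.\<close>

definition vertex_of :: "'h rooted_map \<Rightarrow> 'h \<Rightarrow> 'h set" where
  "vertex_of G h = orbit (vperm G) h"

definition edge_of :: "'h rooted_map \<Rightarrow> 'h \<Rightarrow> 'h set" where
  "edge_of G h = {h, einv G h}"

definition vertices :: "'h rooted_map \<Rightarrow> 'h set set" where
  "vertices G = vertex_of G ` halfedges G"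

definition edges :: "'h rooted_map \<Rightarrow> 'h set set" where
  "edges G = edge_of G ` halfedges G"

definition root_vertex :: "'h rooted_map \<Rightarrow> 'h set" where
  "root_vertex G = vertex_of G (root_halfedge G)"

definition spanning_connected :: "'h rooted_map \<Rightarrow> 'h set set \<Rightarrow> bool" where
  "spanning_connected G T \<longleftrightarrow>
     (\<forall>u\<in>vertices G. \<forall>v\<in>vertices G.
        (u, v) \<in> {(vertex_of G h, vertex_of G (einv G h)) | h.
                    h \<in> halfedges G \<and> edge_of G h \<in> T}\<^sup>*)"

text \<open>A simple cycle is given by the half-edges through which its vertices are left. Distinctness
  of the edges excludes traversing a single edge back and forth; a loop is a cycle of length one
  and two parallel edges form a cycle of length two.\<close>

definition simple_cycle :: "'h rooted_map \<Rightarrow> 'h list \<Rightarrow> bool" where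
  "simple_cycle G hs \<longleftrightarrow>
     hs \<noteq> [] \<and> set hs \<subseteq> halfedges G \<and>
     distinct (map (vertex_of G) hs) \<and> distinct (map (edge_of G) hs) \<and>
     (\<forall>i<length hs.
        vertex_of G (einv G (hs ! i)) = vertex_of G (hs ! (Suc i mod length hs)))"

definition spanning_trees :: "'h rooted_map \<Rightarrow> 'h set set set" where
  "spanning_trees G =
     {T. T \<subseteq> edges G \<and> spanning_connected G T \<and>
         \<not> (\<exists>hs. simple_cycle G hs \<and> edge_of G ` set hs \<subseteq> T)}"

definition motion :: "'h rooted_map \<Rightarrow> 'h set set \<Rightarrow> 'h \<Rightarrow> 'h" where
  "motion G T h = (if edge_of G h \<in> T then vperm G (einv G h) else vperm G h)"

definition position :: "'h rooted_map \<Rightarrow> 'h set set \<Rightarrow> 'h \<Rightarrow> nat" where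
  "position G T h = (LEAST k. (motion G T ^^ k) (root_halfedge G) = h)"

definition halfedge_less :: "'h rooted_map \<Rightarrow> 'h set set \<Rightarrow> 'h \<Rightarrow> 'h \<Rightarrow> bool" where
  "halfedge_less G T h h' \<longleftrightarrow> position G T h < position G T h'"

definition edge_le :: "'h rooted_map \<Rightarrow> 'h set set \<Rightarrow> 'h set \<Rightarrow> 'h set \<Rightarrow> bool" where
  "edge_le G T e e' \<longleftrightarrow> Min (position G T ` e) \<le> Min (position G T ` e')"

text \<open>The exchange \<open>T - e' + e\<close> is written with the insertion first, so that \<open>e\<close> belongs to its own
  fundamental cycle.\<close>

definition fundamental_cycle :: "'h rooted_map \<Rightarrow> 'h set set \<Rightarrow> 'h set \<Rightarrow> 'h set set" where
  "fundamental_cycle G T e = {e' \<in> edges G. insert e T - {e'} \<in> spanning_trees G}"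

definition fundamental_cocycle :: "'h rooted_map \<Rightarrow> 'h set set \<Rightarrow> 'h set \<Rightarrow> 'h set set" where
  "fundamental_cocycle G T e = {e' \<in> edges G. insert e' (T - {e}) \<in> spanning_trees G}"

definition active :: "'h rooted_map \<Rightarrow> 'h set set \<Rightarrow> 'h set \<Rightarrow> bool" where
  "active G T e \<longleftrightarrow>
     (let C = (if e \<in> T then fundamental_cocycle G T e else fundamental_cycle G T e)
      in e \<in> C \<and> (\<forall>e'\<in>C. edge_le G T e e'))"

definition tails :: "'h rooted_map \<Rightarrow> 'h set set \<Rightarrow> 'h set" where
  "tails G T = {h \<in> halfedges G.
     if edge_of G h \<in> T then halfedge_less G T h (einv G h) else halfedge_less G T (einv G h) h}"

definition heads :: "'h rooted_map \<Rightarrow> 'h set set \<Rightarrow> 'h set" where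
  "heads G T = {h \<in> halfedges G.
     if edge_of G h \<in> T then halfedge_less G T (einv G h) h else halfedge_less G T h (einv G h)}"

text \<open>A configuration on the vertices is an extensional function, \<open>undefined\<close> off \<open>vertices G\<close>.\<close>

definition tree_configuration :: "'h rooted_map \<Rightarrow> 'h set set \<Rightarrow> 'h set \<Rightarrow> nat" where
  "tree_configuration G T = (\<lambda>v\<in>vertices G.
     card {h \<in> v. h \<in> tails G T} +
     card {h \<in> v. h \<in> heads G T \<and> edge_of G h \<notin> T \<and> active G T (edge_of G h)})"

definition configurations :: "'h rooted_map \<Rightarrow> ('h set \<Rightarrow> nat) set" where
  "configurations G = vertices G \<rightarrow>\<^sub>E UNIV"

definition vdeg :: "'h set \<Rightarrow> nat" where
  "vdeg v = card v"

definition deg_between :: "'h rooted_map \<Rightarrow> 'h set \<Rightarrow> 'h set \<Rightarrow> nat" where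
  "deg_between G u v = card {e \<in> edges G. \<exists>h. e = edge_of G h \<and> h \<in> u \<and> einv G h \<in> v}"

definition deg_nonloop :: "'h rooted_map \<Rightarrow> 'h set \<Rightarrow> nat" where
  "deg_nonloop G v = card {e \<in> edges G. \<exists>h. e = edge_of G h \<and> h \<in> v \<and> einv G h \<notin> v}"

definition topple :: "'h rooted_map \<Rightarrow> 'h set \<Rightarrow> ('h set \<Rightarrow> nat) \<Rightarrow> ('h set \<Rightarrow> nat)" where
  "topple G v S = (\<lambda>u\<in>vertices G.
     if u = v then S v - deg_nonloop G v else S u + deg_between G u v)"

inductive toppling_sequence ::
  "'h rooted_map \<Rightarrow> ('h set \<Rightarrow> nat) \<Rightarrow> 'h set list \<Rightarrow> ('h set \<Rightarrow> nat) \<Rightarrow> bool"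
  for G :: "'h rooted_map" where
  Nil: "toppling_sequence G S [] S"
| Cons: "v \<in> vertices G \<Longrightarrow> vdeg v \<le> S v \<Longrightarrow> toppling_sequence G (topple G v S) vs S' \<Longrightarrow>
         toppling_sequence G S (v # vs) S'"

definition stable :: "'h rooted_map \<Rightarrow> ('h set \<Rightarrow> nat) \<Rightarrow> bool" where
  "stable G S \<longleftrightarrow> (\<forall>v\<in>vertices G. v \<noteq> root_vertex G \<longrightarrow> S v < vdeg v)"

definition recurrent :: "'h rooted_map \<Rightarrow> ('h set \<Rightarrow> nat) \<Rightarrow> bool" where
  "recurrent G S \<longleftrightarrow>
     stable G S \<and> S (root_vertex G) = vdeg (root_vertex G) \<and>
     (\<exists>vs. distinct (root_vertex G # vs) \<and> set (root_vertex G # vs) = vertices G \<and>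
           toppling_sequence G S (root_vertex G # vs) S)"

end

theory Submission
  imports Defs
begin

text \<open>The motion of \<open>T\<close>, run backwards, is the motion of \<open>T\<close> on the mirror map, whose vertex
  permutation is the inverse of \<open>\<sigma>\<close>. Along this reversed tour every edge of the tree orientation
  points from its first to its second half-edge, and an external edge is active iff the tour had
  already been at the vertex of its head when it met its tail. Hence the deficit \<open>deg u - S\<^sub>T u\<close> is the number
  of half-edges \<open>h\<close> at \<open>u\<close> such that the tour meets the opposite half-edge \<open>\<alpha> h\<close> before it first
  arrives at \<open>u\<close>. This is Dhar's burning algorithm: fire travels with the tour and \<open>u\<close> ignites as
  soon as as many of its edges have burnt as its deficit. Toppling the vertices in the order of
  arrival shows that \<open>S\<^sub>T\<close> is recurrent. Conversely the deficits alone decide at each newly met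
  edge whether it belongs to the tree, so \<open>T\<close> can be recovered from \<open>S\<^sub>T\<close>; and for a recurrent
  configuration the same decisions build a forest whose tour reaches every vertex, because a
  valid toppling order leaves no set of vertices that the fire cannot enter.\<close>

locale combinatorial_map =
  fixes G :: "'h rooted_map"
  assumes is_map: "rooted_combinatorial_map G"
begin

abbreviation "H \<equiv> halfedges G"
abbreviation "\<alpha> \<equiv> einv G"
abbreviation "V \<equiv> vertex_of G"
abbreviation "E \<equiv> edge_of G"
abbreviation "v0 \<equiv> root_vertex G"

section \<open>Half-edges, vertices as orbits, edges as pairs\<close>

lemma finite_H: "finite H"
  and vperm_permutes: "vperm G permutes H"
  and einv_permutes: "\<alpha> permutes H"
  and root_in_H: "root_halfedge G \<in> H"
  and einv_neq: "h \<in> H \<Longrightarrow> \<alpha> h \<noteq> h"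
  using is_map by (auto simp: rooted_combinatorial_map_def)

text \<open>Off \<open>H\<close> the involution is the identity because it permutes
  \<open>H\<close>, so no membership premise is needed.\<close>

lemma einv_einv [simp]: "\<alpha> (\<alpha> h) = h"
  using is_map permutes_not_in[OF einv_permutes]
  by (cases "h \<in> H") (auto simp: rooted_combinatorial_map_def)

lemma einv_in_H [simp]: "\<alpha> h \<in> H \<longleftrightarrow> h \<in> H"
  using permutes_in_image[OF einv_permutes] .

lemma permutation_vperm: "permutation (vperm G)"
  using permutes_imp_permutation[OF finite_H vperm_permutes] .

lemma inv_vperm_in_H [simp]: "inv (vperm G) h \<in> H \<longleftrightarrow> h \<in> H"
  using permutes_in_image[OF permutes_inv[OF vperm_permutes]] .

lemma in_vertex_of [simp]: "h \<in> V h"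
  unfolding vertex_of_def by (rule permutation_self_in_orbit[OF permutation_vperm])

lemma vertex_of_eqI: "h' \<in> V h \<Longrightarrow> V h' = V h"
  unfolding vertex_of_def
  by (rule orbit_cyclic_eq3[OF cyclic_on_orbit[OF vperm_permutes finite_H]])

lemma in_vertex_of_iff: "h' \<in> V h \<longleftrightarrow> V h' = V h"
  using vertex_of_eqI in_vertex_of by metis

lemma vertex_of_inv_vperm [simp]: "V (inv (vperm G) h) = V h"
proof -
  have "inv (vperm G) h \<in> orbit (inv (vperm G)) h"
    by (rule orbit.base)
  then show ?thesis
    using in_vertex_of_iff orbit_inv_eq[OF permutation_vperm] by (simp add: vertex_of_def)
qed

lemma vertex_of_subset: "h \<in> H \<Longrightarrow> V h \<subseteq> H"
  unfolding vertex_of_def by (rule permutes_orbit_subset[OF vperm_permutes])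

lemma vertex_subset: "u \<in> vertices G \<Longrightarrow> u \<subseteq> H"
  using vertex_of_subset by (auto simp: vertices_def)

lemma finite_vertex: "u \<in> vertices G \<Longrightarrow> finite u"
  using vertex_subset finite_H finite_subset by blast

lemma finite_vertices: "finite (vertices G)"
  using finite_H by (simp add: vertices_def)

lemma vertex_of_in_vertices: "h \<in> H \<Longrightarrow> V h \<in> vertices G"
  by (simp add: vertices_def)

lemma in_vertex_iff: "u \<in> vertices G \<Longrightarrow> h \<in> u \<longleftrightarrow> V h = u"
  unfolding vertices_def using in_vertex_of_iff by (metis imageE)

lemma root_vertex_in_vertices: "v0 \<in> vertices G"
  by (simp add: root_vertex_def vertex_of_in_vertices root_in_H)

lemma edge_of_einv [simp]: "E (\<alpha> h) = E h"
  by (auto simp: edge_of_def)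

lemma edge_of_eq_iff: "E h = E h' \<longleftrightarrow> h' = h \<or> h' = \<alpha> h"
  by (auto simp: edge_of_def doubleton_eq_iff)

subsection \<open>Connectivity and cycles\<close>

definition adj :: "'h set set \<Rightarrow> ('h set \<times> 'h set) set" where
  "adj T = {(V h, V (\<alpha> h)) | h. h \<in> H \<and> E h \<in> T}"

definition forest :: "'h set set \<Rightarrow> bool" where
  "forest T \<longleftrightarrow> \<not> (\<exists>hs. simple_cycle G hs \<and> E ` set hs \<subseteq> T)"

lemma spanning_trees_iff:
  "T \<in> spanning_trees G \<longleftrightarrow> T \<subseteq> edges G \<and> forest T \<and>
     (\<forall>u\<in>vertices G. \<forall>v\<in>vertices G. (u, v) \<in> (adj T)\<^sup>*)"
  by (auto simp: spanning_trees_def forest_def adj_def spanning_connected_def)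

lemma adjI: "h \<in> H \<Longrightarrow> E h \<in> T \<Longrightarrow> (V h, V (\<alpha> h)) \<in> adj T"
  by (auto simp: adj_def)

lemma connected_sym: "(u, v) \<in> (adj T)\<^sup>* \<Longrightarrow> (v, u) \<in> (adj T)\<^sup>*"
proof -
  have "sym (adj T)"
  proof (rule symI)
    fix x y assume "(x, y) \<in> adj T"
    then obtain h where "h \<in> H" "E h \<in> T" "x = V h" "y = V (\<alpha> h)"
      by (auto simp: adj_def)
    then show "(y, x) \<in> adj T"
      using adjI[of "\<alpha> h" T] by simp
  qed
  then show "(u, v) \<in> (adj T)\<^sup>* \<Longrightarrow> (v, u) \<in> (adj T)\<^sup>*"
    using sym_rtrancl symD by metis
qed

lemma connected_mono: "(u, v) \<in> (adj T)\<^sup>* \<Longrightarrow> T \<subseteq> T' \<Longrightarrow> (u, v) \<in> (adj T')\<^sup>*"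
  by (rule rtrancl_mono[THEN subsetD]) (auto simp: adj_def)

lemma forest_mono: "forest T' \<Longrightarrow> T \<subseteq> T' \<Longrightarrow> forest T"
  by (auto simp: forest_def)

text \<open>A path without repeated vertices, encoded as in \<open>simple_cycle\<close>: each entry
  is the half-edge through which a vertex is left, and the end \<open>w\<close>, which is not left,
  is kept apart. One more half-edge in front can then close the path to a simple cycle.\<close>

inductive vertex_path :: "'h set set \<Rightarrow> 'h set \<Rightarrow> 'h list \<Rightarrow> 'h set \<Rightarrow> bool" for T where
  Nil: "vertex_path T w [] w"
| Cons: "h \<in> H \<Longrightarrow> E h \<in> T \<Longrightarrow> vertex_path T (V (\<alpha> h)) hs w \<Longrightarrow> V h \<notin> V ` set hs \<Longrightarrow> V h \<noteq> w \<Longrightarrow>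
    vertex_path T (V h) (h # hs) w"

lemma vertex_path_suffix:
  "vertex_path T u hs w \<Longrightarrow> v \<in> insert w (V ` set hs) \<Longrightarrow> \<exists>hs'. vertex_path T v hs' w"
  by (induction rule: vertex_path.induct) (auto intro: vertex_path.intros)

text \<open>Loop erasure: if the new first vertex already lies on the path, the path is cut down to
  its suffix from there.\<close>

lemma connected_imp_vertex_path:
  "(u, w) \<in> (adj T)\<^sup>* \<Longrightarrow> \<exists>hs. vertex_path T u hs w"
proof (induction rule: converse_rtrancl_induct)
  case base
  then show ?case by (auto intro: vertex_path.intros)
next
  case (step u v)
  then obtain hs h where h: "vertex_path T v hs w" "u = V h" "v = V (\<alpha> h)" "h \<in> H" "E h \<in> T"
    by (auto simp: adj_def)
  show ?case
  proof (cases "u \<in> insert w (V ` set hs)")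
    case True
    then show ?thesis using vertex_path_suffix[OF h(1)] by blast
  next
    case False
    then show ?thesis using vertex_path.Cons[of h T hs w] h by auto
  qed
qed

lemma vertex_path_edges: "vertex_path T u hs w \<Longrightarrow> set hs \<subseteq> H \<and> E ` set hs \<subseteq> T"
  by (induction rule: vertex_path.induct) auto

lemma vertex_path_nth:
  "vertex_path T u hs w \<Longrightarrow> (map V hs @ [w]) ! 0 = u \<and>
     (\<forall>i<length hs. V (\<alpha> (hs ! i)) = (map V hs @ [w]) ! Suc i)"
proof (induction rule: vertex_path.induct)
  case Nil
  then show ?case by simp
next
  case (Cons h hs w)
  have "V (\<alpha> ((h # hs) ! i)) = (map V (h # hs) @ [w]) ! Suc i" if "i < length (h # hs)" for i
    using that Cons.IH by (cases i) simp_all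
  then show ?case by simp
qed

lemma vertex_path_distinct:
  "vertex_path T u hs w \<Longrightarrow> distinct (map V hs) \<and> w \<notin> V ` set hs \<and> distinct (map E hs)"
proof (induction rule: vertex_path.induct)
  case Nil
  then show ?case by simp
next
  case (Cons h hs w)
  \<comment> \<open>Reusing the edge through \<open>h\<close> would leave \<open>V h\<close> again,
    reusing it through \<open>\<alpha> h\<close> would lead back to \<open>V h\<close>; either way
    \<open>V h\<close> would occur twice on the path.\<close>
  have "E h \<notin> E ` set hs"
  proof
    assume "E h \<in> E ` set hs"
    then obtain i where i: "i < length hs" "hs ! i = h \<or> hs ! i = \<alpha> h"
      by (auto simp: edge_of_eq_iff in_set_conv_nth)
    have "V (\<alpha> (hs ! i)) = (map V hs @ [w]) ! Suc i"
      using vertex_path_nth[OF Cons.hyps(3)] i by simp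
    also have "\<dots> \<in> set (map V hs @ [w])"
      using i by (intro nth_mem) simp
    finally have "V (\<alpha> (hs ! i)) \<in> insert w (V ` set hs)"
      by simp
    moreover have "V (hs ! i) \<in> V ` set hs"
      using i by simp
    ultimately show False
      using Cons.hyps i(2) by auto
  qed
  then show ?case
    using Cons.IH Cons.hyps by simp
qed

text \<open>A path joining the two ends without the edge would be closed by \<open>h\<close> to a
  simple cycle in \<open>T\<close>. A loop is covered by the empty path.\<close>

lemma forest_edge_disconnects:
  assumes "forest T" "h \<in> H" "E h \<in> T"
  shows "(V h, V (\<alpha> h)) \<notin> (adj (T - {E h}))\<^sup>*"
proof
  assume "(V h, V (\<alpha> h)) \<in> (adj (T - {E h}))\<^sup>*"
  then obtain hs where hs: "vertex_path (T - {E h}) (V (\<alpha> h)) hs (V h)"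
    using connected_imp_vertex_path connected_sym by blast
  note p = vertex_path_nth[OF hs] vertex_path_edges[OF hs] vertex_path_distinct[OF hs]
  \<comment> \<open>\<open>map V hs @ [V h]\<close> lists the vertices of the path; its last entry
    is also the vertex of the first entry of \<open>h # hs\<close>, which is the wrap-around of the
    index.\<close>
  have "V (\<alpha> ((h # hs) ! i)) = V ((h # hs) ! (Suc i mod length (h # hs)))"
    if "i < length (h # hs)" for i
  proof -
    have "V (\<alpha> ((h # hs) ! i)) = (map V hs @ [V h]) ! i"
      using that p by (cases i) simp_all
    also have "\<dots> = V ((h # hs) ! (Suc i mod length (h # hs)))"
      using that by (cases "i = length hs") (simp_all add: nth_append)
    finally show ?thesis .
  qed
  then have "simple_cycle G (h # hs)"
    using p assms unfolding simple_cycle_def by (simp, blast)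
  moreover have "E ` set (h # hs) \<subseteq> T"
    using p assms by auto
  ultimately show False
    using assms(1) unfolding forest_def by blast
qed

text \<open>A cycle in the enlarged set must use the new edge, and the rest of that cycle joins the
  two ends inside \<open>T\<close>.\<close>

lemma forest_insert:
  assumes "forest T" "(V h, V (\<alpha> h)) \<notin> (adj T)\<^sup>*"
  shows "forest (insert (E h) T)"
  unfolding forest_def
proof clarify
  fix hs assume cyc: "simple_cycle G hs" and sub: "E ` set hs \<subseteq> insert (E h) T"
  define n where "n = length hs"
  have n: "n > 0" using cyc by (auto simp: simple_cycle_def n_def)
  have dist: "distinct (map E hs)" and step: "\<And>i. i < n \<Longrightarrow> V (\<alpha> (hs ! i)) = V (hs ! (Suc i mod n))"
    and inH: "set hs \<subseteq> H"
    using cyc by (auto simp: simple_cycle_def n_def)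
  have "E h \<in> E ` set hs"
  proof (rule ccontr)
    assume "E h \<notin> E ` set hs"
    then have "E ` set hs \<subseteq> T"
      using subset_insert sub by metis
    then show False
      using assms(1) cyc unfolding forest_def by blast
  qed
  then obtain i where i: "i < n" "E (hs ! i) = E h"
    by (auto simp: n_def in_set_conv_nth)
  \<comment> \<open>Walk round the cycle starting behind position \<open>i\<close>; at
    \<open>j = n - 1\<close> the index is back at \<open>i\<close>.\<close>
  have "(V (\<alpha> (hs ! i)), V (hs ! ((Suc i + j) mod n))) \<in> (adj T)\<^sup>*" if "j < n" for j
    using that
  proof (induction j)
    case 0
    then show ?case using step[OF i(1)] by simp
  next
    case (Suc j)
    define l where "l = (Suc i + j) mod n"
    have l: "l < n" "Suc l mod n = (Suc i + Suc j) mod n"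
      using n by (simp_all add: l_def mod_Suc_eq)
    have "l \<noteq> i"
    proof
      assume "l = i"
      then show False
        using i Suc.prems unfolding l_def by (cases "Suc i + j < n") (simp_all add: mod_if split: if_splits)
    qed
    then have "E (hs ! l) \<noteq> E h"
      using i l nth_eq_iff_index_eq[OF dist, of l i] by (simp add: n_def)
    moreover have "hs ! l \<in> set hs"
      using l(1) by (simp add: n_def)
    ultimately have "E (hs ! l) \<in> T" "hs ! l \<in> H"
      using sub inH by (metis image_subset_iff insertE, metis subsetD)
    then have "(V (hs ! l), V (\<alpha> (hs ! l))) \<in> adj T"
      by (rule adjI[rotated])
    then show ?case
      using Suc.IH Suc.prems step[OF l(1)] l(2) unfolding l_def[symmetric]
      by (metis Suc_lessD rtrancl.rtrancl_into_rtrancl)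
  qed
  from this[of "n - 1"] have "(V (\<alpha> (hs ! i)), V (hs ! i)) \<in> (adj T)\<^sup>*"
    using i by simp
  moreover have "hs ! i = h \<or> hs ! i = \<alpha> h"
    using i(2) edge_of_eq_iff by metis
  ultimately show False
    using assms(2) connected_sym by (metis einv_einv)
qed

subsection \<open>The reversed tour\<close>

definition flip :: "'h set set \<Rightarrow> 'h \<Rightarrow> 'h" where
  "flip T h = (if E h \<in> T then \<alpha> h else h)"

lemma flip_flip [simp]: "flip T (flip T h) = h"
  by (simp add: flip_def)

lemma flip_in_H [simp]: "flip T h \<in> H \<longleftrightarrow> h \<in> H"
  by (simp add: flip_def)

text \<open>The motion is \<open>vperm G\<close> after \<open>flip T\<close>, so this is the inverse
  of the motion conjugated by \<open>flip T\<close>.\<close>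

definition back_step :: "'h set set \<Rightarrow> 'h \<Rightarrow> 'h" where
  "back_step T h = inv (vperm G) (flip T h)"

text \<open>The start is \<open>flip T\<close> of the predecessor of the root under the motion. It
  lies in the root vertex and does not depend on \<open>T\<close>, so the tours of different
  \<open>T\<close> can be compared from time 0 on.\<close>

definition tour :: "'h set set \<Rightarrow> nat \<Rightarrow> 'h" where
  "tour T i = (back_step T ^^ i) (inv (vperm G) (root_halfedge G))"

lemma tour_Suc: "tour T (Suc i) = inv (vperm G) (flip T (tour T i))"
  by (simp add: tour_def back_step_def)

lemma tour_in_H [simp]: "tour T i \<in> H"
  by (induction i) (simp_all add: tour_Suc, simp add: tour_def root_in_H)

lemma vertex_of_tour_0: "V (tour T 0) = v0"
  by (simp add: tour_def root_vertex_def)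

lemma vertex_of_tour_Suc:
  "V (tour T (Suc i)) = (if E (tour T i) \<in> T then V (\<alpha> (tour T i)) else V (tour T i))"
  by (simp add: tour_Suc flip_def)

lemma tour_Suc_inj: "tour T (Suc i) = tour T (Suc j) \<Longrightarrow> tour T i = tour T j"
  unfolding tour_Suc using permutes_inj[OF permutes_inv[OF vperm_permutes]]
  by (metis flip_flip injD)

lemma tour_shift: "tour T i = tour T j \<Longrightarrow> tour T (i + k) = tour T (j + k)"
  by (induction k) (simp_all add: tour_Suc)

lemma tour_unshift: "tour T (i + k) = tour T (j + k) \<Longrightarrow> tour T i = tour T j"
  by (induction k) (auto dest: tour_Suc_inj)

text \<open>\<open>T\<close> is arbitrary here: the tour of a forest that does not span may close up
  before it has met all of \<open>H\<close>.\<close>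

definition period :: "'h set set \<Rightarrow> nat" where
  "period T = (LEAST p. 0 < p \<and> tour T p = tour T 0)"

text \<open>Finiteness of \<open>H\<close> forces a repetition, and injectivity of the step slides
  it back to time 0.\<close>

lemma period_pos: "0 < period T" and tour_period: "tour T (period T) = tour T 0"
proof -
  have "\<not> inj (tour T)"
  proof
    assume "inj (tour T)"
    then have "infinite (range (tour T))"
      using finite_imageD infinite_UNIV_nat by blast
    then show False
      using finite_subset[OF _ finite_H, of "range (tour T)"] by (simp add: image_subset_iff)
  qed
  then obtain i j where "tour T i = tour T j" "i < j"
    unfolding inj_def by (metis linorder_neqE_nat)
  then have "0 < j - i \<and> tour T (j - i) = tour T 0"
    using tour_unshift[of T "j - i" i 0] by simp
  then have "0 < period T \<and> tour T (period T) = tour T 0"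
    unfolding period_def by (rule LeastI)
  then show "0 < period T" "tour T (period T) = tour T 0"
    by auto
qed

lemma tour_eq_imp_period_le:
  assumes "tour T i = tour T j" "i < j"
  shows "period T \<le> j - i"
  unfolding period_def using assms tour_unshift[of T "j - i" i 0] by (intro Least_le) simp

lemma inj_on_tour: "inj_on (tour T) {..<period T}"
proof (rule linorder_inj_onI)
  fix i j assume "i < j" "i \<in> {..<period T}" "j \<in> {..<period T}"
  then show "tour T i \<noteq> tour T j"
    using tour_eq_imp_period_le[of T i j] by auto
qed auto

lemma tour_add_period: "tour T (i + period T) = tour T i"
  using tour_shift[OF tour_period[of T], of i] by (simp add: add.commute)

lemma tour_before_period: "\<exists>j<period T. tour T j = tour T i"
proof (induction i)
  case 0
  then show ?case using period_pos by blast
next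
  case (Suc i)
  then obtain j where j: "j < period T" "tour T j = tour T i" by blast
  then have "tour T (Suc j) = tour T (Suc i)"
    by (simp add: tour_Suc)
  then show ?case
    using j tour_period period_pos by (metis Suc_lessI)
qed

lemma range_tour: "range (tour T) = tour T ` {..<period T}"
proof
  show "range (tour T) \<subseteq> tour T ` {..<period T}"
  proof clarify
    fix i
    obtain j where "j < period T" "tour T j = tour T i"
      using tour_before_period by blast
    then show "tour T i \<in> tour T ` {..<period T}"
      by (metis imageI lessThan_iff)
  qed
qed auto

lemma period_le: "period T \<le> card H"
  using card_mono[OF finite_H, of "tour T ` {..<period T}"] card_image[OF inj_on_tour, of T]
  by (simp add: image_subset_iff)

text \<open>The tour changes vertex only across edges of \<open>T\<close>. Hence a stretch that
  avoids an edge joins its first and last vertex without that edge, which can be played against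
  \<open>forest_edge_disconnects\<close>.\<close>

lemma tour_segment_connected:
  assumes "i \<le> j" "\<And>l. i \<le> l \<Longrightarrow> l < j \<Longrightarrow> E (tour T l) \<in> T \<Longrightarrow> E (tour T l) \<in> T'"
  shows "(V (tour T i), V (tour T j)) \<in> (adj T')\<^sup>*"
  using assms
proof (induction j rule: dec_induct)
  case base
  then show ?case by simp
next
  case (step j)
  then have "(V (tour T i), V (tour T j)) \<in> (adj T')\<^sup>*"
    by simp
  moreover have "(V (tour T j), V (tour T (Suc j))) \<in> (adj T')\<^sup>*"
    using step.prems[of j] step.hyps adjI[of "tour T j" T']
    by (auto simp: vertex_of_tour_Suc simp del: tour_Suc)
  ultimately show ?case by (rule rtrancl_trans)
qed

text \<open>One period after crossing the edge the tour is back where it started. If it never met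
  the opposite half-edge, it would have returned without using the edge, which a forest
  forbids.\<close>

lemma forest_tour_closed_einv:
  assumes "forest T" "E (tour T i) \<in> T"
  shows "\<alpha> (tour T i) \<in> range (tour T)"
proof (rule ccontr)
  assume not: "\<alpha> (tour T i) \<notin> range (tour T)"
  have "(V (tour T (Suc i)), V (tour T (i + period T))) \<in> (adj (T - {E (tour T i)}))\<^sup>*"
  proof (rule tour_segment_connected)
    show "Suc i \<le> i + period T" using period_pos[of T] by simp
    fix l assume l: "Suc i \<le> l" "l < i + period T" "E (tour T l) \<in> T"
    have "tour T l \<noteq> tour T i"
      using tour_eq_imp_period_le[of T i l] l by force
    moreover have "tour T l \<noteq> \<alpha> (tour T i)"
      using not by (metis rangeI)
    ultimately show "E (tour T l) \<in> T - {E (tour T i)}"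
      using l edge_of_eq_iff by (metis Diff_iff singletonD)
  qed
  then have "(V (tour T i), V (\<alpha> (tour T i))) \<in> (adj (T - {E (tour T i)}))\<^sup>*"
    using assms(2) connected_sym by (simp add: vertex_of_tour_Suc tour_add_period)
  then show False
    using forest_edge_disconnects[OF assms(1) _ assms(2)] by simp
qed

text \<open>\<open>inv (vperm G) h\<close> is the successor of \<open>flip T h\<close>, which is met
  by closure under crossing tree edges; iteration exhausts the orbit.\<close>

lemma forest_tour_closed_vertex:
  assumes "forest T" "h \<in> range (tour T)"
  shows "V h \<subseteq> range (tour T)"
proof -
  have step: "inv (vperm G) h \<in> range (tour T)" if h: "h \<in> range (tour T)" for h
  proof -
    obtain i where i: "h = tour T i"
      using h by blast
    have "flip T h \<in> range (tour T)"
      using forest_tour_closed_einv[OF assms(1), of i] h by (simp add: flip_def i)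
    then obtain j where "flip T h = tour T j"
      by blast
    then have "inv (vperm G) h = tour T (Suc j)"
      by (metis tour_Suc flip_flip)
    then show ?thesis by simp
  qed
  have "h' \<in> range (tour T)" if "h' \<in> orbit (inv (vperm G)) h" for h'
    using that by induction (use step assms in auto)
  then show ?thesis
    using orbit_inv_eq[OF permutation_vperm] by (auto simp: vertex_of_def)
qed

text \<open>The set of half-edges met is closed under turning round a vertex and under crossing tree
  edges, so connectivity spreads it from the root vertex to all of \<open>H\<close>.\<close>

lemma spanning_tree_range_tour:
  assumes "T \<in> spanning_trees G"
  shows "range (tour T) = H"
proof
  show "range (tour T) \<subseteq> H" by auto
  have f: "forest T" and conn: "\<And>u v. u \<in> vertices G \<Longrightarrow> v \<in> vertices G \<Longrightarrow> (u, v) \<in> (adj T)\<^sup>*"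
    using assms by (auto simp: spanning_trees_iff)
  have "w \<subseteq> range (tour T)" if "(v0, w) \<in> (adj T)\<^sup>*" for w
    using that
  proof induction
    case base
    then show ?case
      using forest_tour_closed_vertex[OF f, of "tour T 0"] by (simp add: vertex_of_tour_0)
  next
    case (step u w)
    then obtain h where h: "u = V h" "w = V (\<alpha> h)" "h \<in> H" "E h \<in> T"
      by (auto simp: adj_def)
    then have "h \<in> range (tour T)"
      using step.IH in_vertex_of by blast
    then have "\<alpha> h \<in> range (tour T)"
      using forest_tour_closed_einv[OF f] h(4) by blast
    then show ?case
      using forest_tour_closed_vertex[OF f] h(2) by blast
  qed
  then show "H \<subseteq> range (tour T)"
    using conn root_vertex_in_vertices vertex_of_in_vertices in_vertex_of by blast
qed

lemma spanning_tree_period: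
  assumes "T \<in> spanning_trees G"
  shows "period T = card H"
  using spanning_tree_range_tour[OF assms] card_image[OF inj_on_tour, of T] by (simp add: range_tour)

section \<open>Times of first visit and first arrival\<close>

definition visit :: "'h set set \<Rightarrow> 'h \<Rightarrow> nat" where
  "visit T h = (LEAST i. tour T i = h)"

definition arrival :: "'h set set \<Rightarrow> 'h set \<Rightarrow> nat" where
  "arrival T u = (LEAST i. tour T i \<in> u)"

lemma visit_tour: "i < period T \<Longrightarrow> visit T (tour T i) = i"
proof -
  assume i: "i < period T"
  have "visit T (tour T i) \<le> i" "tour T (visit T (tour T i)) = tour T i"
    unfolding visit_def by (auto intro: Least_le LeastI)
  then show ?thesis
    using i inj_onD[OF inj_on_tour, of T "visit T (tour T i)" i] by simp
qed

lemma arrival_le: "tour T i \<in> u \<Longrightarrow> arrival T u \<le> i"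
  unfolding arrival_def by (rule Least_le)

lemma tour_arrival: "tour T i \<in> u \<Longrightarrow> tour T (arrival T u) \<in> u"
  unfolding arrival_def by (rule LeastI)

lemma before_arrival: "i < arrival T u \<Longrightarrow> tour T i \<notin> u"
  unfolding arrival_def by (rule not_less_Least)

lemma arrival_root: "arrival T v0 = 0"
  using arrival_le[of T 0 v0] by (metis in_vertex_of le_zero_eq vertex_of_tour_0)

lemma arrival_less_period: "tour T i \<in> u \<Longrightarrow> arrival T u < period T"
  using tour_before_period arrival_le by (metis le_less_trans)

text \<open>\<open>tour T j\<close> is the last half-edge before the arrival; the change of vertex
  right after it forces a crossing of a tree edge.\<close>

lemma arrival_edge:
  assumes "u \<in> vertices G" "u \<noteq> v0" "tour T i \<in> u"
  obtains j where "arrival T u = Suc j" "E (tour T j) \<in> T" "\<alpha> (tour T j) \<in> u" "tour T j \<notin> u"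
    "tour T j \<notin> tour T ` {..<j}"
proof -
  have "arrival T u \<noteq> 0"
    using tour_arrival[OF assms(3)] assms(1,2) in_vertex_iff vertex_of_tour_0 by metis
  then obtain j where j: "arrival T u = Suc j"
    using not0_implies_Suc by blast
  have in_u: "tour T (Suc j) \<in> u" and not_u: "tour T j \<notin> u"
    using tour_arrival[OF assms(3)] before_arrival[of j T u] j by auto
  then have e: "E (tour T j) \<in> T" "\<alpha> (tour T j) \<in> u"
    using assms(1) by (auto simp: in_vertex_iff vertex_of_tour_Suc split: if_splits)
  \<comment> \<open>Had the same half-edge been met earlier, its successor would already have been
    at \<open>u\<close>.\<close>
  have "tour T j \<notin> tour T ` {..<j}"
  proof
    assume "tour T j \<in> tour T ` {..<j}"
    then obtain l where "l < j" "tour T l = tour T j" by auto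
    then show False
      using in_u before_arrival[of "Suc l" T u] j by (simp add: tour_Suc)
  qed
  then show thesis using that j e not_u by blast
qed

text \<open>Had the tour been at the far end before, the stretch from then to \<open>i\<close> would
  join the two ends of the edge without using it.\<close>

lemma forest_edge_leads_to_new_vertex:
  assumes "forest T" "E (tour T i) \<in> T"
    "tour T i \<notin> tour T ` {..<i}" "\<alpha> (tour T i) \<notin> tour T ` {..<i}" "j \<le> i"
  shows "tour T j \<notin> V (\<alpha> (tour T i))"
proof
  assume "tour T j \<in> V (\<alpha> (tour T i))"
  then have eq: "V (tour T j) = V (\<alpha> (tour T i))"
    by (rule vertex_of_eqI)
  have "(V (tour T j), V (tour T i)) \<in> (adj (T - {E (tour T i)}))\<^sup>*"
  proof (rule tour_segment_connected[OF assms(5)])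
    fix l assume l: "j \<le> l" "l < i" "E (tour T l) \<in> T"
    then have "tour T l \<noteq> tour T i" "tour T l \<noteq> \<alpha> (tour T i)"
      using assms(3,4) by (metis imageI lessThan_iff)+
    then show "E (tour T l) \<in> T - {E (tour T i)}"
      using l edge_of_eq_iff by (metis Diff_iff singletonD)
  qed
  then show False
    using forest_edge_disconnects[OF assms(1) _ assms(2)] connected_sym eq by simp
qed

subsection \<open>Activity in terms of the reversed tour\<close>

lemma tour_visit: "h \<in> range (tour T) \<Longrightarrow> tour T (visit T h) = h"
  unfolding visit_def by (rule LeastI_ex) auto

lemma visit_less_period: "h \<in> range (tour T) \<Longrightarrow> visit T h < period T"
  unfolding visit_def using tour_before_period by (metis (mono_tags, lifting) Least_le imageE le_less_trans)

lemma visit_eqD: "h \<in> range (tour T) \<Longrightarrow> h' \<in> range (tour T) \<Longrightarrow> visit T h = visit T h' \<Longrightarrow> h = h'"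
  using tour_visit by metis

lemma visit_le: "visit T (tour T i) \<le> i"
  unfolding visit_def by (rule Least_le) simp

lemma motion_flip_tour: "motion G T (flip T (tour T (Suc i))) = flip T (tour T i)"
proof -
  have "motion G T h = vperm G (flip T h)" for h
    by (simp add: motion_def flip_def)
  then show ?thesis
    by (simp add: tour_Suc permutes_inverses[OF vperm_permutes])
qed

text \<open>Up to \<open>flip\<close>, the reversed tour runs through the \<open>(G,T)\<close>-order backwards.\<close>

lemma position_flip_tour:
  assumes "T \<in> spanning_trees G" "i < card H"
  shows "position G T (flip T (tour T i)) = card H - 1 - i"
proof -
  define n where "n = card H"
  have per: "period T = n"
    using spanning_tree_period[OF assms(1)] n_def by simp
  have n: "0 < n" using assms(2) n_def by simp
  \<comment> \<open>The step out of time \<open>n - 1\<close> returns to the start; cancelling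
    \<open>inv (vperm G)\<close> identifies \<open>flip T\<close> of the last half-edge with the
    root.\<close>
  have "tour T (Suc (n - 1)) = tour T 0"
    using tour_period[of T] per n by simp
  then have "inv (vperm G) (flip T (tour T (n - 1))) = inv (vperm G) (root_halfedge G)"
    by (simp only: tour_Suc) (simp add: tour_def)
  then have root: "flip T (tour T (n - 1)) = root_halfedge G"
    using permutes_inj[OF permutes_inv[OF vperm_permutes]] by (metis injD)
  have pow: "(motion G T ^^ j) (root_halfedge G) = flip T (tour T (n - 1 - j))" if "j < n" for j
    using that
  proof (induction j)
    case 0
    then show ?case using root by simp
  next
    case (Suc j)
    then have "n - 1 - j = Suc (n - 1 - Suc j)" by simp
    then show ?case using Suc motion_flip_tour by simp
  qed
  show ?thesis
    unfolding position_def n_def[symmetric]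
  proof (rule Least_equality)
    show "(motion G T ^^ (n - 1 - i)) (root_halfedge G) = flip T (tour T i)"
      using pow[of "n - 1 - i"] assms(2) n_def by simp
  next
    fix y assume y: "(motion G T ^^ y) (root_halfedge G) = flip T (tour T i)"
    show "n - 1 - i \<le> y"
    proof (rule ccontr)
      assume less: "\<not> n - 1 - i \<le> y"
      then have "tour T (n - 1 - y) = tour T i"
        using pow[of y] y assms(2) by (metis flip_flip diff_le_self leI less_le_trans n_def)
      then have "n - 1 - y = i"
        using inj_onD[OF inj_on_tour, of T "n - 1 - y" i] per n assms(2) n_def by simp
      then show False using less by simp
    qed
  qed
qed

context
  fixes T assumes tree: "T \<in> spanning_trees G"
begin

lemma tour_visit_tree: "h \<in> H \<Longrightarrow> tour T (visit T h) = h"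
  using tour_visit spanning_tree_range_tour[OF tree] by simp

lemma visit_less_card: "h \<in> H \<Longrightarrow> visit T h < card H"
  using visit_less_period[of h T] spanning_tree_range_tour[OF tree] spanning_tree_period[OF tree] by simp

lemma visit_eqD_tree: "h \<in> H \<Longrightarrow> h' \<in> H \<Longrightarrow> visit T h = visit T h' \<Longrightarrow> h = h'"
  using visit_eqD[of h T h'] spanning_tree_range_tour[OF tree] by simp

lemma position_eq: "h \<in> H \<Longrightarrow> position G T h = card H - 1 - visit T (flip T h)"
  using position_flip_tour[OF tree visit_less_card, of "flip T h"] tour_visit_tree[of "flip T h"]
  by simp

text \<open>\<open>flip T\<close> maps every edge onto itself and the order is reversed, so the
  smaller position comes from the later visit.\<close>

lemma Min_position_edge:
  assumes "h \<in> H"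
  shows "Min (position G T ` E h) = card H - 1 - max (visit T h) (visit T (\<alpha> h))"
  using assms by (auto simp: edge_of_def[of G h] position_eq flip_def max_def min_def)

lemma edge_le_iff:
  assumes "h \<in> H" "g \<in> H"
  shows "edge_le G T (E h) (E g) \<longleftrightarrow> max (visit T g) (visit T (\<alpha> g)) \<le> max (visit T h) (visit T (\<alpha> h))"
  using assms visit_less_card[of h] visit_less_card[of g] visit_less_card[of "\<alpha> h"] visit_less_card[of "\<alpha> g"]
  unfolding edge_le_def by (simp add: Min_position_edge) linarith

text \<open>For an external edge only the order is reversed; for an internal one
  \<open>flip T\<close> also exchanges the two half-edges. This absorbs the case distinction in the
  orientation.\<close>

lemma tails_iff: "h \<in> H \<Longrightarrow> h \<in> tails G T \<longleftrightarrow> visit T h < visit T (\<alpha> h)"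
  using visit_less_card[of h] visit_less_card[of "\<alpha> h"]
  by (auto simp: tails_def halfedge_less_def position_eq flip_def)

lemma heads_iff: "h \<in> H \<Longrightarrow> h \<in> heads G T \<longleftrightarrow> visit T (\<alpha> h) < visit T h"
  using visit_less_card[of h] visit_less_card[of "\<alpha> h"]
  by (auto simp: heads_def halfedge_less_def position_eq flip_def)

lemma tour_eq_iff_tree: "i < card H \<Longrightarrow> h \<in> H \<Longrightarrow> tour T i = h \<longleftrightarrow> i = visit T h"
  using visit_tour[of i T] spanning_tree_period[OF tree] tour_visit_tree by metis

lemma forest_tree: "forest T"
  using tree by (simp add: spanning_trees_iff)

text \<open>\<open>E h\<close> is an edge of the exchanged tree, and deleting it there leaves
  \<open>T - {e}\<close>.\<close>

lemma fundamental_cycle_disconnects: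
  assumes "h \<in> H" "E h \<notin> T" "e \<in> fundamental_cycle G T (E h)" "e \<noteq> E h"
  shows "(V h, V (\<alpha> h)) \<notin> (adj (T - {e}))\<^sup>*"
proof -
  have "forest (insert (E h) T - {e})"
    using assms(3) by (auto simp: fundamental_cycle_def spanning_trees_iff)
  moreover have "insert (E h) T - {e} - {E h} = T - {e}"
    using assms(2) by blast
  ultimately show ?thesis
    using forest_edge_disconnects[of "insert (E h) T - {e}" h] assms by simp
qed

text \<open>Both stretches of the reversed tour, from the arrival in \<open>V h\<close> to \<open>\<alpha> h\<close> and from there to \<open>h\<close>,
  use every edge of the fundamental cycle, hence they contain both its half-edges.\<close>

lemma active_if_arrived:
  assumes h: "h \<in> H" "E h \<notin> T" "visit T (\<alpha> h) < visit T h" and arr: "arrival T (V h) \<le> visit T (\<alpha> h)"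
  shows "active G T (E h)"
proof -
  define i j m where "i = visit T (\<alpha> h)" and "j = visit T h" and "m = arrival T (V h)"
  have ij: "tour T i = \<alpha> h" "tour T j = h" "i < j" "m \<le> i" "j < card H"
    using h arr tour_visit_tree visit_less_card by (auto simp: i_def j_def m_def)
  have "tour T m \<in> V h"
    unfolding m_def using tour_arrival[of T j "V h"] ij by simp
  then have Vm: "V (tour T m) = V h"
    by (rule vertex_of_eqI)
  have "edge_le G T (E h) e" if e: "e \<in> fundamental_cycle G T (E h)" for e
  proof (cases "e = E h")
    case True
    then show ?thesis by (simp add: edge_le_def)
  next
    case False
    note dis = fundamental_cycle_disconnects[OF h(1,2) e False]
    obtain g where g: "g \<in> H" "e = E g"
      using e by (auto simp: fundamental_cycle_def edges_def)
    have "\<exists>l. m \<le> l \<and> l < i \<and> E (tour T l) = e"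
    proof (rule ccontr)
      assume "\<not> ?thesis"
      then have "(V (tour T m), V (tour T i)) \<in> (adj (T - {e}))\<^sup>*"
        by (intro tour_segment_connected ij) blast
      then show False using dis ij Vm by simp
    qed
    then obtain l where l: "l < i" "E (tour T l) = e" by blast
    have "\<exists>l. i \<le> l \<and> l < j \<and> E (tour T l) = e"
    proof (rule ccontr)
      assume "\<not> ?thesis"
      then have "(V (tour T i), V (tour T j)) \<in> (adj (T - {e}))\<^sup>*"
        using ij by (intro tour_segment_connected) auto
      then show False using dis ij connected_sym by simp
    qed
    then obtain l' where l': "i \<le> l'" "l' < j" "E (tour T l') = e" by blast
    \<comment> \<open>Different times within one period give different half-edges, so the two
      crossings account for both half-edges of \<open>e\<close>, each met before
      \<open>j\<close>.\<close>
    have "tour T l \<noteq> tour T l'"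
      using l l' ij tour_eq_iff_tree[of l "tour T l'"] tour_eq_iff_tree[of l' "tour T l'"] by simp
    then have "(tour T l = g \<and> tour T l' = \<alpha> g) \<or> (tour T l = \<alpha> g \<and> tour T l' = g)"
      using l l' g edge_of_eq_iff by metis
    then have "max (visit T g) (visit T (\<alpha> g)) \<le> j"
      using visit_le[of T l] visit_le[of T l'] l l' ij by auto
    then show ?thesis
      using g h by (simp add: edge_le_iff j_def)
  qed
  moreover have "E h \<in> fundamental_cycle G T (E h)"
    using tree h by (auto simp: fundamental_cycle_def edges_def)
  ultimately show ?thesis
    using h by (simp add: active_def)
qed

text \<open>The edge through which \<open>V h\<close> is entered lies on the fundamental cycle and is crossed back only
  after \<open>h\<close>.\<close>

lemma not_active_if_not_arrived:
  assumes h: "h \<in> H" "E h \<notin> T" and arr: "visit T (\<alpha> h) < arrival T (V h)"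
  shows "\<not> active G T (E h)"
proof
  assume act: "active G T (E h)"
  define i j where "i = visit T (\<alpha> h)" and "j = visit T h"
  have ij: "tour T i = \<alpha> h" "tour T j = h" "j < card H" "i < card H"
    using h tour_visit_tree visit_less_card by (auto simp: i_def j_def)
  have "V h \<noteq> v0"
    using arr arrival_root by (metis not_less_zero)
  moreover have "tour T j \<in> V h"
    using ij by simp
  ultimately obtain k where k: "arrival T (V h) = Suc k" "E (tour T k) \<in> T" "\<alpha> (tour T k) \<in> V h"
      "tour T k \<notin> V h"
    using arrival_edge[OF vertex_of_in_vertices[OF h(1)]] by metis
  define x where "x = tour T k"
  define l where "l = visit T (\<alpha> x)"
  have x: "x \<in> H" "E x \<in> T" "V (\<alpha> x) = V h"
    using k by (simp_all add: x_def vertex_of_eqI)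
  have arr_j: "arrival T (V h) \<le> j"
    using arrival_le[of T j] ij by simp
  have tl: "tour T l = \<alpha> x" "l < card H"
    using tour_visit_tree visit_less_card x by (simp_all add: l_def)
  then have kl: "k < l"
    using arrival_le[of T l "V h"] k(1,3) x_def by simp
  \<comment> \<open>Within the period, \<open>E x\<close> is met only on entering \<open>V h\<close>
    at time \<open>k\<close> and on crossing back at time \<open>l\<close>.\<close>
  have only: "E (tour T q) \<noteq> E x" if "q < card H" "q \<noteq> k" "q \<noteq> l" for q
    using that tour_eq_iff_tree[of q x] tour_eq_iff_tree[of k x] tour_eq_iff_tree[of q "\<alpha> x"] x kl tl
      edge_of_eq_iff[of x "tour T q"] by (auto simp: l_def x_def[symmetric])
  note dis = forest_edge_disconnects[OF forest_tree x(1,2)]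
  \<comment> \<open>After crossing back the tour is on the side of \<open>V x\<close>, and it could
    reach \<open>h\<close> only over \<open>E x\<close> again.\<close>
  have "j < l"
  proof (rule ccontr)
    assume "\<not> j < l"
    moreover have "l \<noteq> j"
      using tl ij x h by (metis edge_of_einv)
    ultimately have "l < j" by simp
    have "(V (tour T (Suc l)), V (tour T j)) \<in> (adj (T - {E x}))\<^sup>*"
      using only kl \<open>l < j\<close> ij(3) by (intro tour_segment_connected) auto
    then show False
      using dis tl x ij by (simp add: vertex_of_tour_Suc)
  qed
  have seg: "(V (\<alpha> h), V x) \<in> (adj (T - {E x}))\<^sup>*"
    using tour_segment_connected[of i k T "T - {E x}"] only kl tl arr k(1) ij unfolding x_def i_def
    by auto
  \<comment> \<open>The exchange of \<open>E x\<close> for \<open>E h\<close>; once it is seen to be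
    a tree, \<open>E x\<close> lies on the fundamental cycle, and its later visit \<open>l\<close>
    beats that of \<open>E h\<close>.\<close>
  define T' where "T' = insert (E h) (T - {E x})"
  have "(V h, V (\<alpha> h)) \<notin> (adj (T - {E x}))\<^sup>*"
    using seg dis x(3) connected_sym rtrancl_trans by metis
  then have "forest T'"
    unfolding T'_def using forest_mono[OF forest_tree] by (intro forest_insert) auto
  moreover have "T' \<subseteq> edges G"
    using tree h by (auto simp: T'_def spanning_trees_iff edges_def)
  moreover have "(u, v) \<in> (adj T')\<^sup>*" if "u \<in> vertices G" "v \<in> vertices G" for u v
  proof -
    have "(V x, V (\<alpha> h)) \<in> (adj T')\<^sup>*"
      using connected_sym[OF connected_mono[OF seg, of T']] by (auto simp: T'_def)
    moreover have "(V (\<alpha> h), V h) \<in> adj T'"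
      using adjI[of "\<alpha> h" T'] h by (simp add: T'_def)
    ultimately have cross: "(V x, V (\<alpha> x)) \<in> (adj T')\<^sup>*"
      using x(3) by simp
    have "adj T \<subseteq> (adj T')\<^sup>*"
    proof
      fix p assume "p \<in> adj T"
      then obtain g where g: "p = (V g, V (\<alpha> g))" "g \<in> H" "E g \<in> T"
        by (auto simp: adj_def)
      show "p \<in> (adj T')\<^sup>*"
      proof (cases "E g = E x")
        case True
        then have "g = x \<or> g = \<alpha> x"
          using edge_of_eq_iff by metis
        then show ?thesis
          using g cross connected_sym by auto
      next
        case False
        then show ?thesis
          using g adjI[of g T'] by (simp add: T'_def r_into_rtrancl)
      qed
    qed
    then show ?thesis
      using that tree rtrancl_subset_rtrancl[of "adj T" "adj T'"] by (auto simp: spanning_trees_iff)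
  qed
  ultimately have "T' \<in> spanning_trees G"
    by (simp add: spanning_trees_iff)
  moreover have "insert (E h) T - {E x} = T'"
    using h(2) x(2) by (auto simp: T'_def)
  ultimately have "E x \<in> fundamental_cycle G T (E h)"
    using x(1) by (simp add: fundamental_cycle_def edges_def)
  then have "edge_le G T (E h) (E x)"
    using act h by (simp add: active_def Let_def)
  then have "l \<le> max j i"
    using x h by (simp add: edge_le_iff l_def i_def j_def)
  then show False
    using \<open>j < l\<close> arr arr_j by (simp add: i_def)
qed

end

subsection \<open>The configuration of a tree\<close>

definition deficit :: "'h set set \<Rightarrow> 'h set \<Rightarrow> nat" where
  "deficit T u = card {h \<in> u. \<alpha> h \<in> tour T ` {..<arrival T u}}"

text \<open>The half-edges at \<open>u\<close> split into tails (\<open>A\<close>), heads of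
  external active edges (\<open>B\<close>) and those counted by the deficit (\<open>C\<close>). A
  remaining head is internal or inactive, and in both cases its opposite was met before the arrival
  at \<open>u\<close>.\<close>

lemma tree_configuration_add_deficit:
  assumes tree: "T \<in> spanning_trees G" and u: "u \<in> vertices G"
  shows "tree_configuration G T u + deficit T u = card u"
proof -
  define A B C where "A = {h \<in> u. h \<in> tails G T}"
    and "B = {h \<in> u. h \<in> heads G T \<and> E h \<notin> T \<and> active G T (E h)}"
    and "C = {h \<in> u. \<alpha> h \<in> tour T ` {..<arrival T u}}"
  have H: "h \<in> H" "V h = u" "arrival T u \<le> visit T h" "\<alpha> h \<in> H" if "h \<in> u" for h
    using that vertex_subset[OF u] in_vertex_iff[OF u] arrival_le[of T "visit T h" u]
      tour_visit_tree[OF tree, of h] by auto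
  have C_iff: "h \<in> C \<longleftrightarrow> visit T (\<alpha> h) < arrival T u" if "h \<in> u" for h
  proof -
    have "\<alpha> h \<in> tour T ` {..<arrival T u} \<longleftrightarrow> visit T (\<alpha> h) < arrival T u"
      using tour_visit_tree[OF tree H(4)[OF that]] visit_le by (metis imageE imageI le_less_trans lessThan_iff)
    then show ?thesis using that by (simp add: C_def)
  qed
  have "A \<inter> B = {}"
    using H by (auto simp: A_def B_def tails_iff[OF tree] heads_iff[OF tree])
  moreover have "(A \<union> B) \<inter> C = {}"
  proof -
    have "h \<notin> C" if "h \<in> A" for h
      using that H[of h] C_iff[of h] by (auto simp: A_def tails_iff[OF tree])
    moreover have "h \<notin> C" if "h \<in> B" for h
      using that H[of h] C_iff[of h] not_active_if_not_arrived[OF tree, of h] by (auto simp: B_def)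
    ultimately show ?thesis by blast
  qed
  moreover have "u = A \<union> B \<union> C"
  proof
    show "u \<subseteq> A \<union> B \<union> C"
    proof
      fix h assume "h \<in> u"
      note h = this H[OF this] C_iff[OF this]
      have "\<alpha> h \<noteq> h" using h einv_neq by simp
      then consider "visit T h < visit T (\<alpha> h)" | "visit T (\<alpha> h) < visit T h"
        using visit_eqD_tree[OF tree, of "\<alpha> h" h] h by (meson nat_neq_iff)
      then show "h \<in> A \<union> B \<union> C"
      proof cases
        case 1
        then show ?thesis using h by (simp add: A_def tails_iff[OF tree])
      next
        case 2
        show ?thesis
        proof (cases "E h \<in> T")
          case True
          define i where "i = visit T (\<alpha> h)"
          have i: "tour T i = \<alpha> h" using h tour_visit_tree[OF tree] by (simp add: i_def)
          have "\<alpha> h \<notin> tour T ` {..<i}" "h \<notin> tour T ` {..<i}"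
            using visit_le[of T] 2 by (auto simp: i_def) (metis leD, metis leD less_trans)
          \<comment> \<open>A tree edge met for the first time leads to a vertex where the tour has
            not yet been.\<close>
          then have "tour T q \<notin> u" if "q \<le> i" for q
            using forest_edge_leads_to_new_vertex[OF forest_tree[OF tree], of i q] i True h that by simp
          then have "i < arrival T u"
            using tour_arrival[of T "visit T h" u] tour_visit_tree[OF tree, of h] h by (metis not_less)
          then show ?thesis using h by (simp add: i_def)
        next
          case False
          then show ?thesis
            using h 2 active_if_arrived[OF tree, of h] by (auto simp: B_def heads_iff[OF tree])
        qed
      qed
    qed
  qed (auto simp: A_def B_def C_def)
  moreover have "finite A" "finite B" "finite C"
    using finite_vertex[OF u] by (auto simp: A_def B_def C_def)
  ultimately have "card u = card A + card B + card C"
    by (metis card_Un_disjoint finite_UnI)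
  then show ?thesis
    using u by (simp add: tree_configuration_def deficit_def A_def B_def C_def)
qed

subsection \<open>Topplings\<close>

text \<open>Loops are left out because toppling sends nothing along them; it is then immaterial
  whether \<open>u\<close> itself belongs to \<open>X\<close>.\<close>

definition edges_into :: "'h set \<Rightarrow> 'h set set \<Rightarrow> nat" where
  "edges_into u X = card {h \<in> u. \<alpha> h \<notin> u \<and> V (\<alpha> h) \<in> X}"

text \<open>Degrees count edges, the rest of the proof counts half-edges; the counts agree when no
  edge has both half-edges at \<open>u\<close>.\<close>

lemma card_edge_of_image:
  assumes "A \<subseteq> u" "\<And>h. h \<in> A \<Longrightarrow> \<alpha> h \<notin> u"
  shows "card (E ` A) = card A"
  by (rule card_image) (use assms in \<open>auto simp: inj_on_def edge_of_eq_iff\<close>)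

lemma deg_between_eq:
  assumes "u \<in> vertices G" "v \<in> vertices G" "u \<noteq> v"
  shows "deg_between G u v = card {h \<in> u. \<alpha> h \<in> v}"
proof -
  have "{e \<in> edges G. \<exists>h. e = E h \<and> h \<in> u \<and> \<alpha> h \<in> v} = E ` {h \<in> u. \<alpha> h \<in> v}"
    using vertex_subset[OF assms(1)] by (auto simp: edges_def)
  moreover have "\<alpha> h \<notin> u" if "\<alpha> h \<in> v" for h
    using that assms in_vertex_iff by metis
  then have "card (E ` {h \<in> u. \<alpha> h \<in> v}) = card {h \<in> u. \<alpha> h \<in> v}"
    by (intro card_edge_of_image[of _ u]) auto
  ultimately show ?thesis
    by (simp only: deg_between_def)
qed

lemma deg_nonloop_eq:
  assumes "v \<in> vertices G"
  shows "deg_nonloop G v = card {h \<in> v. \<alpha> h \<notin> v}"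
proof -
  have "{e \<in> edges G. \<exists>h. e = E h \<and> h \<in> v \<and> \<alpha> h \<notin> v} = E ` {h \<in> v. \<alpha> h \<notin> v}"
    using vertex_subset[OF assms(1)] by (auto simp: edges_def)
  moreover have "card (E ` {h \<in> v. \<alpha> h \<notin> v}) = card {h \<in> v. \<alpha> h \<notin> v}"
    by (rule card_edge_of_image[of _ v]) auto
  ultimately show ?thesis
    by (simp only: deg_nonloop_def)
qed

lemma edges_into_mono:
  assumes "u \<in> vertices G" "X \<subseteq> Y"
  shows "edges_into u X \<le> edges_into u Y"
  unfolding edges_into_def using assms finite_vertex[OF assms(1)] by (intro card_mono) auto

lemma edges_into_empty [simp]: "edges_into u {} = 0"
  by (simp add: edges_into_def)

lemma edges_into_vertices:
  assumes u: "u \<in> vertices G"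
  shows "edges_into u (vertices G) = deg_nonloop G u"
proof -
  have "V (\<alpha> h) \<in> vertices G" if "h \<in> u" for h
    using that vertex_subset[OF u] vertex_of_in_vertices[of "\<alpha> h"] by auto
  then have "{h \<in> u. \<alpha> h \<notin> u \<and> V (\<alpha> h) \<in> vertices G} = {h \<in> u. \<alpha> h \<notin> u}"
    by auto
  then show ?thesis
    by (simp add: edges_into_def deg_nonloop_eq[OF u])
qed

lemma edges_into_insert_self:
  assumes u: "u \<in> vertices G"
  shows "edges_into u (insert u X) = edges_into u X"
  unfolding edges_into_def by (simp add: in_vertex_iff[OF u] cong: conj_cong)

lemma edges_into_insert:
  assumes u: "u \<in> vertices G" and v: "v \<in> vertices G" and "u \<noteq> v" "v \<notin> X"
  shows "edges_into u (insert v X) = edges_into u X + deg_between G u v"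
proof -
  have iff: "\<alpha> h \<notin> u \<and> V (\<alpha> h) \<in> insert v X \<longleftrightarrow> (\<alpha> h \<notin> u \<and> V (\<alpha> h) \<in> X) \<or> \<alpha> h \<in> v" for h
    unfolding in_vertex_iff[OF u] in_vertex_iff[OF v] using assms(3,4) by (metis insert_iff)
  have disj: "\<not> (V (\<alpha> h) \<in> X \<and> \<alpha> h \<in> v)" for h
    unfolding in_vertex_iff[OF v] using assms(4) by metis
  have "{h \<in> u. \<alpha> h \<notin> u \<and> V (\<alpha> h) \<in> insert v X} =
      {h \<in> u. \<alpha> h \<notin> u \<and> V (\<alpha> h) \<in> X} \<union> {h \<in> u. \<alpha> h \<in> v}"
    unfolding iff by blast
  moreover have "{h \<in> u. \<alpha> h \<notin> u \<and> V (\<alpha> h) \<in> X} \<inter> {h \<in> u. \<alpha> h \<in> v} = {}"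
    using disj by blast
  ultimately show ?thesis
    unfolding edges_into_def deg_between_eq[OF u v assms(3)]
    using finite_vertex[OF u] by (simp only: card_Un_disjoint finite_Collect_conjI Collect_mem_eq simp_thms)
qed

text \<open>Closed form of the configuration after each vertex of \<open>X\<close> has toppled once,
  whatever the order.\<close>

definition toppled :: "('h set \<Rightarrow> nat) \<Rightarrow> 'h set set \<Rightarrow> 'h set \<Rightarrow> nat" where
  "toppled S X = (\<lambda>u\<in>vertices G. S u + edges_into u X - (if u \<in> X then deg_nonloop G u else 0))"

lemma toppled_empty: "S \<in> configurations G \<Longrightarrow> toppled S {} = S"
  by (auto simp: toppled_def configurations_def restrict_def PiE_def extensional_def fun_eq_iff)

text \<open>Each vertex regains along its non-loop edges exactly what it sent out, so returning to
  \<open>S\<close> is automatic.\<close>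

lemma toppled_vertices: "S \<in> configurations G \<Longrightarrow> toppled S (vertices G) = S"
  by (auto simp: toppled_def configurations_def restrict_def PiE_def extensional_def fun_eq_iff
      edges_into_vertices)

lemma topple_toppled:
  assumes "v \<in> vertices G" "v \<notin> X" "\<And>u. u \<in> X \<Longrightarrow> card u \<le> S u + edges_into u X"
  shows "topple G v (toppled S X) = toppled S (insert v X)"
proof
  fix u
  show "topple G v (toppled S X) u = toppled S (insert v X) u"
  proof (cases "u \<in> vertices G")
    case True
    \<comment> \<open>With the hypothesis on \<open>X\<close> this keeps the natural subtraction in
      \<open>toppled\<close> from truncating.\<close>
    have "deg_nonloop G u \<le> card u"
      using True finite_vertex[OF True] by (auto simp: deg_nonloop_eq intro: card_mono)
    then have "deg_nonloop G u \<le> S u + edges_into u X" if "u \<in> X"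
      using assms(3)[OF that] by simp
    then show ?thesis
      using True assms(1,2) by (auto simp: topple_def toppled_def edges_into_insert_self edges_into_insert)
  qed (simp add: topple_def toppled_def)
qed

text \<open>Legality of the topplings read off from the initial \<open>S\<close> alone, as in Dhar's
  burning algorithm.\<close>

fun burns :: "('h set \<Rightarrow> nat) \<Rightarrow> 'h set set \<Rightarrow> 'h set list \<Rightarrow> bool" where
  "burns S X [] \<longleftrightarrow> True"
| "burns S X (u # us) \<longleftrightarrow> u \<in> vertices G \<and> card u \<le> S u + edges_into u X \<and> burns S (insert u X) us"

lemma toppling_sequence_Nil_iff: "toppling_sequence G S [] S' \<longleftrightarrow> S' = S"
  by (auto elim: toppling_sequence.cases intro: toppling_sequence.intros)

lemma toppling_sequence_Cons_iff:
  "toppling_sequence G S (v # vs) S' \<longleftrightarrow>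
     v \<in> vertices G \<and> vdeg v \<le> S v \<and> toppling_sequence G (topple G v S) vs S'"
  by (auto elim: toppling_sequence.cases intro: toppling_sequence.intros)

text \<open>A vertex that has not toppled yet has only gained \<open>edges_into\<close>, so its
  toppling is legal exactly when it burns.\<close>

lemma toppling_sequence_iff_burns:
  assumes "distinct vs" "set vs \<inter> X = {}" "X \<subseteq> vertices G"
    "\<And>u. u \<in> X \<Longrightarrow> card u \<le> S u + edges_into u X"
  shows "toppling_sequence G (toppled S X) vs S' \<longleftrightarrow> burns S X vs \<and> S' = toppled S (X \<union> set vs)"
  using assms
proof (induction vs arbitrary: X)
  case Nil
  then show ?case by (simp add: toppling_sequence_Nil_iff)
next
  case (Cons v vs)
  show ?case
  proof (cases "v \<in> vertices G \<and> card v \<le> S v + edges_into v X")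
    case True
    have "card u \<le> S u + edges_into u (insert v X)" if "u \<in> insert v X" for u
      using that Cons.prems True edges_into_mono[of u X "insert v X"] by fastforce
    then have "toppling_sequence G (toppled S (insert v X)) vs S' \<longleftrightarrow>
        burns S (insert v X) vs \<and> S' = toppled S (insert v X \<union> set vs)"
      using Cons.prems True by (intro Cons.IH) auto
    moreover have "topple G v (toppled S X) = toppled S (insert v X)"
      using Cons.prems True by (intro topple_toppled) auto
    moreover have "toppled S X v = S v + edges_into v X"
      using True Cons.prems(2) by (simp add: toppled_def)
    ultimately show ?thesis
      using True by (simp add: toppling_sequence_Cons_iff vdeg_def)
  next
    case False
    then have "\<not> (v \<in> vertices G \<and> card v \<le> toppled S X v)"
      using Cons.prems(2) by (simp add: toppled_def)
    then show ?thesis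
      using False by (auto simp: toppling_sequence_Cons_iff vdeg_def)
  qed
qed

lemma toppling_sequence_all_iff_burns:
  assumes "S \<in> configurations G" "distinct vs" "set vs = vertices G"
  shows "toppling_sequence G S vs S \<longleftrightarrow> burns S {} vs"
  using toppling_sequence_iff_burns[of vs "{}" S S] assms by (simp add: toppled_empty toppled_vertices)

text \<open>The first vertex of the list outside \<open>W\<close> burns when only vertices of
  \<open>W\<close> have burnt, and enlarging that set to \<open>W\<close> keeps the
  inequality.\<close>

lemma burns_escape:
  "burns S X vs \<Longrightarrow> X \<subseteq> W \<Longrightarrow> \<not> set vs \<subseteq> W \<Longrightarrow>
     \<exists>u\<in>vertices G - W. card u \<le> S u + edges_into u W"
proof (induction vs arbitrary: X)
  case (Cons v vs)
  show ?case
  proof (cases "v \<in> W")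
    case True
    then show ?thesis using Cons by auto
  next
    case False
    have "v \<in> vertices G" "card v \<le> S v + edges_into v X"
      using Cons.prems(1) by simp_all
    then show ?thesis
      using False edges_into_mono[of v X W] Cons.prems(2) by (intro bexI[of _ v]) auto
  qed
qed simp

text \<open>Vertices of smaller \<open>m\<close> cannot come later in the list, so they have burnt
  already.\<close>

lemma burns_sorted:
  assumes "sorted (map m vs)" "vertices G \<subseteq> X \<union> set vs" "set vs \<subseteq> vertices G"
    "\<And>u. u \<in> set vs \<Longrightarrow> card u \<le> S u + edges_into u {w \<in> vertices G. m w < m u}"
  shows "burns S X vs"
  using assms
proof (induction vs arbitrary: X)
  case (Cons v vs)
  have "{w \<in> vertices G. m w < m v} \<subseteq> X"
    using Cons.prems(1,2) by (auto simp: not_less[symmetric])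
  then have "card v \<le> S v + edges_into v X"
    using Cons.prems(3) Cons.prems(4)[of v] edges_into_mono[of v _ X]
    by (meson add_left_mono le_trans list.set_intros(1) subsetD)
  then show ?case
    using Cons.prems by (auto intro!: Cons.IH)
qed simp

section \<open>Configurations of trees are recurrent\<close>

lemma deficit_root: "deficit T v0 = 0"
  by (simp add: deficit_def arrival_root)

text \<open>The half-edge through which \<open>u\<close> is first entered is counted. This yields
  stability.\<close>

lemma deficit_pos:
  assumes "u \<in> vertices G" "u \<noteq> v0" "tour T i \<in> u"
  shows "0 < deficit T u"
proof -
  obtain j where j: "arrival T u = Suc j" "\<alpha> (tour T j) \<in> u"
    using arrival_edge[OF assms] by metis
  then have "\<alpha> (tour T j) \<in> {h \<in> u. \<alpha> h \<in> tour T ` {..<arrival T u}}"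
    by simp
  then show ?thesis
    unfolding deficit_def using finite_vertex[OF assms(1)] by (auto simp: card_gt_0_iff)
qed

text \<open>A half-edge met before the arrival at \<open>u\<close> lies at a different vertex, where
  the tour has therefore arrived earlier.\<close>

lemma deficit_le_edges_into:
  assumes "u \<in> vertices G"
  shows "deficit T u \<le> edges_into u {w \<in> vertices G. arrival T w < arrival T u}"
  unfolding deficit_def edges_into_def
proof (rule card_mono)
  show "finite {h \<in> u. \<alpha> h \<notin> u \<and> V (\<alpha> h) \<in> {w \<in> vertices G. arrival T w < arrival T u}}"
    using finite_vertex[OF assms] by simp
  show "{h \<in> u. \<alpha> h \<in> tour T ` {..<arrival T u}} \<subseteq>
      {h \<in> u. \<alpha> h \<notin> u \<and> V (\<alpha> h) \<in> {w \<in> vertices G. arrival T w < arrival T u}}"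
  proof clarify
    fix h i assume h: "h \<in> u" "\<alpha> h = tour T i" "i < arrival T u"
    have "\<alpha> h \<notin> u"
      using h before_arrival by simp
    moreover have "arrival T (V (\<alpha> h)) < arrival T u"
      using h arrival_le[of T i "V (\<alpha> h)"] by simp
    moreover have "V (\<alpha> h) \<in> vertices G"
      using h by (simp add: vertex_of_in_vertices)
    ultimately show "\<alpha> h \<notin> u \<and> V (\<alpha> h) \<in> {w \<in> vertices G. arrival T w < arrival T u}"
      by simp
  qed
qed

lemma tree_configuration_in_configurations: "tree_configuration G T \<in> configurations G"
  by (simp add: tree_configuration_def configurations_def)

lemma vertex_visited:
  assumes "T \<in> spanning_trees G" "u \<in> vertices G"
  shows "\<exists>i. tour T i \<in> u"
proof -
  obtain h where "h \<in> H" "u = V h"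
    using assms(2) unfolding vertices_def by blast
  then show ?thesis
    using tour_visit_tree[OF assms(1)] in_vertex_of by metis
qed

lemma recurrent_tree_configuration:
  assumes tree: "T \<in> spanning_trees G"
  shows "recurrent G (tree_configuration G T)"
proof -
  let ?S = "tree_configuration G T"
  have sum: "?S u + deficit T u = card u" if "u \<in> vertices G" for u
    using tree_configuration_add_deficit[OF tree that] .
  have "stable G ?S"
    unfolding stable_def vdeg_def
  proof clarify
    fix u assume u: "u \<in> vertices G" "u \<noteq> v0"
    then have "0 < deficit T u"
      using deficit_pos vertex_visited[OF tree] by blast
    then show "?S u < card u"
      using sum[OF u(1)] by simp
  qed
  moreover have root: "?S v0 = card v0"
    using sum[OF root_vertex_in_vertices] deficit_root by simp
  moreover have "\<exists>vs. distinct (v0 # vs) \<and> set (v0 # vs) = vertices G \<and> toppling_sequence G ?S (v0 # vs) ?S"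
  proof -
    obtain xs where xs: "set xs = vertices G - {v0}" "distinct xs"
      using finite_distinct_list[of "vertices G - {v0}"] finite_vertices by auto
    define vs where "vs = sort_key (arrival T) xs"
    have vs: "set vs = vertices G - {v0}" "distinct vs" "sorted (map (arrival T) vs)"
      using xs by (simp_all add: vs_def)
    have "burns ?S {v0} vs"
    proof (rule burns_sorted[OF vs(3)])
      fix u assume "u \<in> set vs"
      then show "card u \<le> ?S u + edges_into u {w \<in> vertices G. arrival T w < arrival T u}"
        using sum[of u] deficit_le_edges_into[of u T] vs by simp
    qed (use vs in auto)
    then have "burns ?S {} (v0 # vs)"
      using root root_vertex_in_vertices by simp
    moreover have "distinct (v0 # vs)" "set (v0 # vs) = vertices G"
      using vs root_vertex_in_vertices by auto
    ultimately show ?thesis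
      using toppling_sequence_all_iff_burns[OF tree_configuration_in_configurations] by blast
  qed
  ultimately show ?thesis
    by (simp add: recurrent_def vdeg_def)
qed

subsection \<open>Reconstructing the tree\<close>

text \<open>The times at which an edge is met for the first time, when its membership in
  \<open>T\<close> has to be decided.\<close>

definition fresh :: "'h set set \<Rightarrow> nat \<Rightarrow> bool" where
  "fresh T i \<longleftrightarrow> tour T i \<notin> tour T ` {..<i} \<and> \<alpha> (tour T i) \<notin> tour T ` {..<i}"

text \<open>The decision rule; the range \<open>..i\<close> includes the current half-edge. It looks
  at \<open>T\<close> only through the tour up to time \<open>i\<close>.\<close>

definition ignites :: "('h set \<Rightarrow> nat) \<Rightarrow> 'h set set \<Rightarrow> nat \<Rightarrow> bool" where
  "ignites D T i \<longleftrightarrow> (let u = V (\<alpha> (tour T i)) in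
     u \<inter> tour T ` {..i} = {} \<and> card {h \<in> u. \<alpha> h \<in> tour T ` {..i}} = D u)"

text \<open>A fresh tree edge leads to a new vertex, so the arrival is at \<open>Suc i\<close> and
  the count is the deficit by definition. Conversely, if \<open>u\<close> were entered only later,
  through \<open>tour T j\<close>, that newly met half-edge would push the deficit above the
  count.\<close>

lemma edge_in_tree_iff_ignites:
  assumes tree: "T \<in> spanning_trees G" and "fresh T i"
  shows "E (tour T i) \<in> T \<longleftrightarrow> ignites (deficit T) T i"
proof -
  define u where "u = V (\<alpha> (tour T i))"
  have u: "u \<in> vertices G"
    by (simp add: u_def vertex_of_in_vertices)
  obtain q where q: "tour T q \<in> u"
    using vertex_visited[OF tree u] by blast
  show ?thesis
  proof
    assume e: "E (tour T i) \<in> T"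
    have new: "tour T j \<notin> u" if "j \<le> i" for j
      using forest_edge_leads_to_new_vertex[OF forest_tree[OF tree] e] assms(2) that
      unfolding u_def fresh_def by blast
    have "V (tour T (Suc i)) = u"
      using e by (simp add: vertex_of_tour_Suc u_def)
    then have "tour T (Suc i) \<in> u"
      using in_vertex_iff[OF u] by simp
    then have "arrival T u = Suc i"
      using arrival_le[of T "Suc i" u] tour_arrival[of T "Suc i" u] new
      by (metis le_antisym not_less_eq_eq)
    then show "ignites (deficit T) T i"
      using new unfolding ignites_def u_def[symmetric] Let_def deficit_def
      by (auto simp: lessThan_Suc_atMost)
  next
    assume ig: "ignites (deficit T) T i"
    then have new: "u \<inter> tour T ` {..i} = {}" and count: "card {h \<in> u. \<alpha> h \<in> tour T ` {..i}} = deficit T u"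
      by (simp_all add: ignites_def Let_def u_def)
    have "u \<noteq> v0"
      using new vertex_of_tour_0[of T] in_vertex_of[of "tour T 0"] by auto
    then obtain j where j: "arrival T u = Suc j" "E (tour T j) \<in> T" "\<alpha> (tour T j) \<in> u" "tour T j \<notin> tour T ` {..<j}"
      using arrival_edge[OF u _ q] by metis
    have "i \<le> j"
      using new tour_arrival[OF q] j(1) by (metis IntI atMost_iff empty_iff imageI not_less_eq_eq)
    moreover have "\<not> i < j"
    proof
      assume ij: "i < j"
      have "{h \<in> u. \<alpha> h \<in> tour T ` {..i}} \<subset> {h \<in> u. \<alpha> h \<in> tour T ` {..<arrival T u}}"
      proof
        show "{h \<in> u. \<alpha> h \<in> tour T ` {..i}} \<subseteq> {h \<in> u. \<alpha> h \<in> tour T ` {..<arrival T u}}"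
          using ij j(1) by force
        have "\<alpha> (tour T j) \<in> {h \<in> u. \<alpha> h \<in> tour T ` {..<arrival T u}}"
          using j by simp
        moreover have "\<alpha> (tour T j) \<notin> {h \<in> u. \<alpha> h \<in> tour T ` {..i}}"
          using j(4) ij by force
        ultimately show "{h \<in> u. \<alpha> h \<in> tour T ` {..i}} \<noteq> {h \<in> u. \<alpha> h \<in> tour T ` {..<arrival T u}}"
          by metis
      qed
      then have "card {h \<in> u. \<alpha> h \<in> tour T ` {..i}} < deficit T u"
        unfolding deficit_def using finite_vertex[OF u] by (intro psubset_card_mono) auto
      then show False using count by simp
    qed
    ultimately show "E (tour T i) \<in> T"
      using j(2) by simp
  qed
qed

lemma ignites_cong:
  assumes "\<And>j. j \<le> i \<Longrightarrow> tour T j = tour T' j"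
  shows "ignites D T i \<longleftrightarrow> ignites D T' i"
proof -
  have "tour T ` {..i} = tour T' ` {..i}" "tour T i = tour T' i"
    using assms by auto
  then show ?thesis by (simp add: ignites_def)
qed

lemma fresh_cong:
  assumes "\<And>j. j \<le> i \<Longrightarrow> tour T j = tour T' j"
  shows "fresh T i \<longleftrightarrow> fresh T' i"
proof -
  have "tour T ` {..<i} = tour T' ` {..<i}" "tour T i = tour T' i"
    using assms by auto
  then show ?thesis by (simp add: fresh_def)
qed

lemma ignites_deficit_cong:
  "(\<And>u. u \<in> vertices G \<Longrightarrow> D u = D' u) \<Longrightarrow> ignites D T i \<longleftrightarrow> ignites D' T i"
  by (simp add: ignites_def Let_def vertex_of_in_vertices)

lemma tour_cong:
  assumes "\<And>j. j < i \<Longrightarrow> E (tour T j) \<in> T \<longleftrightarrow> E (tour T j) \<in> T'" "j \<le> i"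
  shows "tour T j = tour T' j"
  using assms(2)
proof (induction j)
  case 0
  then show ?case by (simp add: tour_def)
next
  case (Suc j)
  then show ?case using assms(1)[of j] by (simp add: tour_Suc flip_def)
qed

text \<open>Induction along the common tour: at fresh times the deficits decide, at other times the
  edge was already decided.\<close>

lemma tree_eqI:
  assumes T: "T \<in> spanning_trees G" and T': "T' \<in> spanning_trees G"
    and eq: "\<And>u. u \<in> vertices G \<Longrightarrow> deficit T u = deficit T' u"
  shows "T = T'"
proof -
  have agree: "E (tour T i) \<in> T \<longleftrightarrow> E (tour T i) \<in> T'" for i
  proof (induction i rule: less_induct)
    case (less i)
    have same: "tour T j = tour T' j" if "j \<le> i" for j
      using tour_cong[OF less that] .
    show ?case
    proof (cases "fresh T i")
      case True
      then show ?thesis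
        using edge_in_tree_iff_ignites[OF T True] edge_in_tree_iff_ignites[OF T', of i] same
          fresh_cong[of i T T'] ignites_cong[of i T T'] ignites_deficit_cong[of "deficit T" "deficit T'"] eq
        by auto
    next
      case False
      then obtain j where "j < i" "tour T i = tour T j \<or> \<alpha> (tour T i) = tour T j"
        unfolding fresh_def by auto
      then show ?thesis
        using less[of j] edge_of_einv by metis
    qed
  qed
  have "e \<in> T \<longleftrightarrow> e \<in> T'" if e: "e \<in> edges G" for e
  proof -
    obtain h where "h \<in> H" "e = E h"
      using e unfolding edges_def by blast
    then show ?thesis
      using agree tour_visit_tree[OF T] by metis
  qed
  then show ?thesis
    using T T' by (auto simp: spanning_trees_iff)
qed

text \<open>Only an edge with both half-edges unmet is inserted into \<open>T\<close>; this leaves the tour up to that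
  point, and hence all earlier decisions, unchanged.\<close>

lemma burning_process:
  "\<exists>T. T \<subseteq> edges G \<and> forest T \<and> (\<forall>e\<in>T. \<exists>j<i. e = E (tour T j)) \<and>
     (\<forall>j<i. fresh T j \<longrightarrow> (E (tour T j) \<in> T \<longleftrightarrow> ignites D T j))"
proof (induction i)
  case 0
  have "forest {}"
    by (auto simp: forest_def simple_cycle_def)
  then show ?case by (intro exI[of _ "{}"]) auto
next
  case (Suc i)
  then obtain T where T: "T \<subseteq> edges G" "forest T" "\<And>e. e \<in> T \<Longrightarrow> \<exists>j<i. e = E (tour T j)"
    "\<And>j. j < i \<Longrightarrow> fresh T j \<Longrightarrow> E (tour T j) \<in> T \<longleftrightarrow> ignites D T j"
    by metis
  define x where "x = tour T i"
  have earlier: "E (tour T j) \<noteq> E x" if "fresh T i" "j < i" for j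
    using that edge_of_eq_iff[of x "tour T j"] unfolding fresh_def x_def by (metis imageI lessThan_iff)
  show ?case
  proof (cases "fresh T i \<and> ignites D T i")
    case False
    have "E x \<notin> T" if "fresh T i"
      using T(3)[of "E x"] earlier[OF that] by metis
    then have "fresh T j \<longrightarrow> (E (tour T j) \<in> T \<longleftrightarrow> ignites D T j)" if "j < Suc i" for j
      using that T(4)[of j] False by (cases "j = i") (auto simp: x_def)
    then show ?thesis
      using T(1-3) less_SucI by (intro exI[of _ T]) metis
  next
    case True
    define T' where "T' = insert (E x) T"
    have same: "tour T j = tour T' j" if "j \<le> i" for j
      using that by (rule tour_cong[rotated]) (use earlier True in \<open>auto simp: T'_def\<close>)
    have new: "tour T j \<notin> V (\<alpha> x)" if "j \<le> i" for j
      using True that by (auto simp: ignites_def Let_def x_def)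
    \<comment> \<open>Every edge of \<open>T\<close> was met before \<open>i\<close>, and the step
      after that meeting crossed it, so both its ends have been visited, unlike
      \<open>V (\<alpha> x)\<close>.\<close>
    have isolated: "V h \<noteq> V (\<alpha> x)" if h: "E h \<in> T" for h
    proof -
      obtain j where j: "j < i" "E h = E (tour T j)"
        using T(3)[OF h] by blast
      then have "h = tour T j \<or> h = \<alpha> (tour T j)"
        using edge_of_eq_iff by metis
      then have "V h = V (tour T j) \<or> V h = V (tour T (Suc j))"
        using h j(2) by (metis vertex_of_tour_Suc)
      then show ?thesis
        using new[of j] new[of "Suc j"] j(1) by (metis Suc_leI in_vertex_of less_imp_le)
    qed
    have "(V x, V (\<alpha> x)) \<notin> (adj T)\<^sup>*"
    proof
      assume "(V x, V (\<alpha> x)) \<in> (adj T)\<^sup>*"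
      then show False
      proof (cases rule: rtranclE)
        case base
        then show ?thesis using new[of i] in_vertex_of[of x] by (metis order_refl x_def)
      next
        case (step w)
        then obtain h where "E h \<in> T" "V (\<alpha> x) = V (\<alpha> h)"
          unfolding adj_def by blast
        then show ?thesis using isolated[of "\<alpha> h"] by simp
      qed
    qed
    then have "forest T'"
      unfolding T'_def by (rule forest_insert[OF T(2)])
    moreover have "T' \<subseteq> edges G"
      using T(1) by (simp add: T'_def edges_def x_def)
    moreover have "\<exists>j<Suc i. e = E (tour T' j)" if e: "e \<in> T'" for e
    proof (cases "e = E x")
      case True
      then show ?thesis using same[of i] by (auto simp: x_def)
    next
      case False
      then obtain j where "j < i" "e = E (tour T j)"
        using e T(3) unfolding T'_def by blast
      then show ?thesis using same[of j] by (metis less_SucI less_imp_le)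
    qed
    moreover have "E (tour T' j) \<in> T' \<longleftrightarrow> ignites D T' j" if "j < Suc i" "fresh T' j" for j
    proof -
      have pre: "tour T l = tour T' l" if "l \<le> j" for l
        using same \<open>j < Suc i\<close> that by simp
      note ignited = True
      show ?thesis
      proof (cases "j = i")
        case True
        then have "E (tour T' j) = E x"
          using same[of i] by (simp add: x_def)
        then have "E (tour T' j) \<in> T'"
          unfolding T'_def by (simp only: insertI1)
        then show ?thesis
          using ignited ignites_cong[OF pre, of j D] True by simp
      next
        case False
        then have "E (tour T j) \<in> T \<longleftrightarrow> ignites D T j"
          using that fresh_cong[OF pre, of j] by (intro T(4)) auto
        moreover have "E (tour T' j) \<in> T' \<longleftrightarrow> E (tour T j) \<in> T"
          using False that(1) earlier[of j] ignited pre[of j] unfolding T'_def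
          by (metis insert_iff less_antisym order_refl)
        ultimately show ?thesis
          using ignites_cong[OF pre, of j D] by simp
      qed
    qed
    ultimately show ?thesis by metis
  qed
qed

text \<open>A count growing by at most one per step cannot jump over \<open>d\<close>.\<close>

lemma count_reaches:
  fixes f :: "nat \<Rightarrow> nat"
  assumes "f 0 < d" "d \<le> f n" "\<And>i. f (Suc i) \<le> Suc (f i)"
  shows "\<exists>i<n. f i < d \<and> f (Suc i) = d"
proof -
  define k where "k = (LEAST k. d \<le> f k)"
  have k: "d \<le> f k" "k \<le> n"
    unfolding k_def using assms(2) by (auto intro: LeastI Least_le)
  then have "k \<noteq> 0" using assms(1) by (cases "k = 0") simp_all
  then obtain i where i: "k = Suc i" using not0_implies_Suc by blast
  then have "\<not> d \<le> f i"
    using not_less_Least[of i "\<lambda>k. d \<le> f k"] k_def by simp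
  then show ?thesis
    using i k assms(3)[of i] by (intro exI[of _ i]) auto
qed

text \<open>Burn with the deficits of \<open>S\<close>. If the tour missed some vertices, the
  toppling order would supply a missed \<open>u\<close> with at least \<open>D u\<close> half-edges
  towards visited ones; at the moment the count hits \<open>D u\<close> the vertex ignites and the
  tour enters it, a contradiction.\<close>

lemma recurrent_is_tree_configuration:
  assumes S: "S \<in> configurations G" and rec: "recurrent G S"
  shows "\<exists>T\<in>spanning_trees G. tree_configuration G T = S"
proof -
  \<comment> \<open>Nothing is truncated on vertices: \<open>S\<close> equals the degree at the root
    and is smaller elsewhere.\<close>
  define D where "D u = card u - S u" for u
  obtain vs where vs: "distinct (v0 # vs)" "set (v0 # vs) = vertices G" "toppling_sequence G S (v0 # vs) S"
    using rec by (auto simp: recurrent_def)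
  have burns: "burns S {} (v0 # vs)"
    using toppling_sequence_all_iff_burns[OF S vs(1,2)] vs(3) by simp
  have less: "S u < card u" if "u \<in> vertices G" "u \<noteq> v0" for u
    using rec that by (auto simp: recurrent_def stable_def vdeg_def)
  have root: "S v0 = card v0"
    using rec by (simp add: recurrent_def vdeg_def)
  \<comment> \<open>\<open>card H\<close> steps suffice because it bounds the period of every
    \<open>T\<close>.\<close>
  obtain T where T: "T \<subseteq> edges G" "forest T"
    "\<And>j. j < card H \<Longrightarrow> fresh T j \<Longrightarrow> E (tour T j) \<in> T \<longleftrightarrow> ignites D T j"
    using burning_process[of "card H" D] by metis
  have dec: "E (tour T j) \<in> T \<longleftrightarrow> ignites D T j" if "j < period T" "fresh T j" for j
    using T(3) that period_le[of T] by simp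
  define W where "W = {u \<in> vertices G. u \<subseteq> range (tour T)}"
  have W: "u \<in> W" if "u \<in> vertices G" "h \<in> u" "h \<in> range (tour T)" for u h
    using forest_tour_closed_vertex[OF T(2) that(3)] that in_vertex_iff[OF that(1)] by (simp add: W_def)
  have all: "vertices G \<subseteq> W"
  proof (rule ccontr)
    assume "\<not> vertices G \<subseteq> W"
    then have "\<exists>u\<in>vertices G - W. card u \<le> S u + edges_into u W"
      using burns_escape[OF burns, of W] unfolding vs(2) by simp
    then obtain u where u: "u \<in> vertices G" "u \<notin> W" "card u \<le> S u + edges_into u W"
      by blast
    have out: "u \<inter> range (tour T) = {}"
      using W u by blast
    have "v0 \<in> W"
      using W[OF root_vertex_in_vertices, of "tour T 0"] in_vertex_iff[OF root_vertex_in_vertices]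
      by (simp add: vertex_of_tour_0)
    then have "u \<noteq> v0" using u by auto
    then have pos: "0 < D u"
      using less[OF u(1)] by (simp add: D_def)
    define f where "f i = card {h \<in> u. \<alpha> h \<in> tour T ` {..<i}}" for i
    have fin: "finite {h \<in> u. P h}" for P
      using finite_vertex[OF u(1)] by simp
    have "edges_into u W \<le> f (period T)"
      unfolding edges_into_def f_def range_tour[symmetric]
    proof (rule card_mono[OF fin])
      show "{h \<in> u. \<alpha> h \<notin> u \<and> V (\<alpha> h) \<in> W} \<subseteq> {h \<in> u. \<alpha> h \<in> range (tour T)}"
        using in_vertex_of by (auto simp: W_def)
    qed
    then have "D u \<le> f (period T)"
      using u(3) by (simp add: D_def)
    moreover have step: "f (Suc i) \<le> Suc (f i)" for i
    proof -
      have "{h \<in> u. \<alpha> h \<in> tour T ` {..<Suc i}} \<subseteq> insert (\<alpha> (tour T i)) {h \<in> u. \<alpha> h \<in> tour T ` {..<i}}"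
        by (auto simp: lessThan_Suc) (metis einv_einv)+
      then have "f (Suc i) \<le> card (insert (\<alpha> (tour T i)) {h \<in> u. \<alpha> h \<in> tour T ` {..<i}})"
        unfolding f_def using fin by (intro card_mono) auto
      also have "\<dots> \<le> Suc (f i)"
        unfolding f_def by (rule card_insert_le_m1) auto
      finally show ?thesis .
    qed
    moreover have "f 0 < D u"
      using pos by (simp add: f_def)
    ultimately obtain i where i: "i < period T" "f i < D u" "f (Suc i) = D u"
      using count_reaches[of f "D u" "period T"] by blast
    \<comment> \<open>The count grows at time \<open>i\<close>, so \<open>tour T i\<close> is newly
      met and its opposite lies at \<open>u\<close>.\<close>
    have "\<not> {h \<in> u. \<alpha> h \<in> tour T ` {..<Suc i}} \<subseteq> {h \<in> u. \<alpha> h \<in> tour T ` {..<i}}"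
      using i card_mono[OF fin, of "{h \<in> u. \<alpha> h \<in> tour T ` {..<Suc i}}" "\<lambda>h. \<alpha> h \<in> tour T ` {..<i}"]
      by (auto simp: f_def)
    then obtain h where h: "h \<in> u" "\<alpha> h \<in> tour T ` {..<Suc i}" "\<alpha> h \<notin> tour T ` {..<i}"
      by blast
    then have "\<alpha> h = tour T i"
      by (auto simp: lessThan_Suc)
    then have hi: "\<alpha> (tour T i) = h" "tour T i \<notin> tour T ` {..<i}"
      using h(3) by (metis einv_einv, simp)
    have Vh: "V h = u"
      using h(1) in_vertex_iff[OF u(1)] by simp
    have "h \<notin> range (tour T)"
      using out h(1) by blast
    then have "fresh T i"
      using hi by (auto simp: fresh_def)
    moreover have "ignites D T i"
      using i(3) out by (auto simp: ignites_def Let_def hi(1) Vh f_def lessThan_Suc_atMost)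
    ultimately have "E (tour T i) \<in> T"
      using dec[OF i(1)] by simp
    then have "V (tour T (Suc i)) = u"
      using hi Vh by (simp add: vertex_of_tour_Suc)
    then show False
      using out in_vertex_iff[OF u(1)] by blast
  qed
  have reach: "\<exists>i. tour T i \<in> u" if "u \<in> vertices G" for u
  proof -
    obtain h where "h \<in> H" "u = V h"
      using \<open>u \<in> vertices G\<close> unfolding vertices_def by blast
    then have "h \<in> range (tour T)"
      using all that W_def in_vertex_of by blast
    then show ?thesis using \<open>u = V h\<close> in_vertex_of by (metis imageE)
  qed
  have conn: "(v0, u) \<in> (adj T)\<^sup>*" if u: "u \<in> vertices G" for u
  proof -
    obtain i where "tour T i \<in> u" using reach[OF u] by blast
    then have "V (tour T i) = u" using in_vertex_iff[OF u] by simp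
    then show ?thesis
      using tour_segment_connected[of 0 i T T] by (simp add: vertex_of_tour_0)
  qed
  have tree: "T \<in> spanning_trees G"
    unfolding spanning_trees_iff using T(1,2) conn connected_sym rtrancl_trans by metis
  \<comment> \<open>The edge through which \<open>u\<close> is first entered is fresh and in
    \<open>T\<close>, so it ignited: its count, which up to time \<open>j\<close> is the deficit,
    equals \<open>D u\<close>.\<close>
  have "deficit T u = D u" if u: "u \<in> vertices G" for u
  proof (cases "u = v0")
    case True
    then show ?thesis using root by (simp add: deficit_root D_def)
  next
    case False
    obtain q where q: "tour T q \<in> u" using reach[OF u] by blast
    obtain j where j: "arrival T u = Suc j" "E (tour T j) \<in> T" "\<alpha> (tour T j) \<in> u" "tour T j \<notin> tour T ` {..<j}"
      using arrival_edge[OF u False q] by metis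
    have "tour T i \<notin> u" if "i < j" for i
      using before_arrival[of i T u] j(1) that by simp
    then have "fresh T j"
      using j(3,4) unfolding fresh_def by (metis imageE lessThan_iff)
    moreover have "j < period T"
      using arrival_less_period[OF q] j(1) by simp
    ultimately have "ignites D T j"
      using dec j(2) by simp
    moreover have "V (\<alpha> (tour T j)) = u"
      using j(3) in_vertex_iff[OF u] by simp
    ultimately show ?thesis
      by (simp add: ignites_def Let_def deficit_def j(1) lessThan_Suc_atMost)
  qed
  then have "tree_configuration G T u = S u" if "u \<in> vertices G" for u
    using tree_configuration_add_deficit[OF tree that] that less[OF that] root by (cases "u = v0") (auto simp: D_def)
  then have "tree_configuration G T = S"
    using S tree_configuration_in_configurations[of T] unfolding configurations_def
    by (intro PiE_ext) auto
  then show ?thesis using tree by blast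
qed

end

theorem theorem51:
  fixes G :: "'h rooted_map"
  assumes "rooted_combinatorial_map G"
  shows "bij_betw (\<lambda>T. tree_configuration G T) (spanning_trees G)
           {S \<in> configurations G. recurrent G S}"
proof -
  interpret combinatorial_map G
    using assms by (rule combinatorial_map.intro)
  show ?thesis
  proof (rule bij_betw_imageI)
    show "inj_on (\<lambda>T. tree_configuration G T) (spanning_trees G)"
    proof (rule inj_onI)
      fix T T' assume T: "T \<in> spanning_trees G" "T' \<in> spanning_trees G"
        "tree_configuration G T = tree_configuration G T'"
      show "T = T'"
        using tree_configuration_add_deficit[OF T(1)] tree_configuration_add_deficit[OF T(2)] T(3)
        by (intro tree_eqI[OF T(1,2)]) (metis add_left_cancel)
    qed
    show "(\<lambda>T. tree_configuration G T) ` spanning_trees G = {S \<in> configurations G. recurrent G S}"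
    proof (intro equalityI subsetI)
      fix S assume "S \<in> (\<lambda>T. tree_configuration G T) ` spanning_trees G"
      then show "S \<in> {S \<in> configurations G. recurrent G S}"
        using tree_configuration_in_configurations recurrent_tree_configuration by blast
    next
      fix S assume "S \<in> {S \<in> configurations G. recurrent G S}"
      then have "\<exists>T\<in>spanning_trees G. tree_configuration G T = S"
        by (intro recurrent_is_tree_configuration) auto
      then show "S \<in> (\<lambda>T. tree_configuration G T) ` spanning_trees G"
        by (metis imageI)
    qed
  qed
qed

end
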